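(* Let $G$ be a countable discrete amenable group acting by homeomorphisms on a compact metric space $(X,d)$, and let $\mathscr C$ be a characteristic class of measure-preserving $G$-systems. Then the set $\mathcal M(\mathscr C)^e$ of ergodic measures $\mu\in\mathcal M_G(X)$ with $(X,G,\mu)\in\mathscr C$ is closed with respect to the metric $\bar\rho$ on $\mathcal M_G(X)$.
   Context: $\mathcal M_G(X)$ is the set of $G$-invariant Borel probability measures on $X$; each $\mu\in\mathcal M_G(X)$ gives a measure-preserving system $(X,G,\mu)$. A measure $\mu\in\mathcal M_G(X)$ is ergodic if every $G$-invariant measurable set has $\mu$-measure $0$ or $1$. A (countable discrete) group is amenable if it admits a (left) Følner sequence, i.e. a sequence $(F_n)_{n\in\mathbb N}$ of non-empty finite subsets with $|gF_n\,\Delta\,F_n|/|F_n|\to 0$ for every $g\in G$. Measure-preserving systems are measure-preserving actions of the fixed group $G$ on standard Borel probability spaces. $(Y,G,\nu)$ is a factor of $(Z,G,\kappa)$ if there is a measurable map $\pi:Z\to Y$ with $\pi(gz)=g\pi(z)$ for $\kappa$-almost every $z$ and every $g\in G$, and $\pi_*\kappa=\nu$. A joining of a family of systems $(X_i,G,\mu_i)_{i\in I}$, $I\subseteq\mathbb N$, is a probability measure on $\prod_{i\in I}X_i$ that is invariant under the product (diagonal) action of $G$ and has marginals $\mu_i$. $J(\mu,\nu)$ is the set of joinings of $\mu$ and $\nu$. A characteristic class is a collection $\mathscr C$ of measure-preserving $G$-systems that is closed under taking factors and under countable (finite or infinite) joinings: a factor of a system in $\mathscr C$ is in $\mathscr C$,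 and if $(X_i,G,\mu_i)\in\mathscr C$ for all $i\in I$ and $\lambda$ is a joining of them, then $(\prod_{i\in I} X_i,G,\lambda)\in\mathscr C$. For $\mu,\nu\in\mathcal M_G(X)$, $\bar\rho(\mu,\nu)=\inf_{\lambda\in J(\mu,\nu)}\int_{X\times X}d(x,z)\,d\lambda(x,z)$; this is a metric on $\mathcal M_G(X)$. *)

theory Defs
  imports "HOL-Probability.Probability" "HOL-Algebra.Group_Action"
begin

text \<open>
  Throughout, \<open>G\<close> is the acting group, an action of \<open>G\<close> on a set \<open>E\<close> is a \<open>group_action G E \<phi>\<close> from
  HOL-Algebra (so every \<open>\<phi> g\<close> is extensional on \<open>E\<close>), and a system is given by a measure \<open>M\<close> together
  with an action \<open>T\<close> on \<open>space M\<close>.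
\<close>

definition folner_sequence :: "('g, 'b) monoid_scheme \<Rightarrow> (nat \<Rightarrow> 'g set) \<Rightarrow> bool" where
  "folner_sequence G F \<longleftrightarrow>
     (\<forall>n. F n \<subseteq> carrier G \<and> finite (F n) \<and> F n \<noteq> {}) \<and>
     (\<forall>g\<in>carrier G.
        (\<lambda>n. real (card (sym_diff (g <#\<^bsub>G\<^esub> F n) (F n))) / real (card (F n))) \<longlonglongrightarrow> 0)"

definition amenable :: "('g, 'b) monoid_scheme \<Rightarrow> bool" where
  "amenable G \<longleftrightarrow> (\<exists>F. folner_sequence G F)"

definition standard_borel :: "'a measure \<Rightarrow> bool" where
  "standard_borel M \<longleftrightarrow>
     (\<exists>\<tau>. topspace \<tau> = space M \<and> completely_metrizable_space \<tau> \<and> separable_space \<tau> \<and>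
          sets M = sigma_sets (space M) {U. openin \<tau> U})"

definition mp_system ::
  "('g, 'b) monoid_scheme \<Rightarrow> 'a measure \<Rightarrow> ('g \<Rightarrow> 'a \<Rightarrow> 'a) \<Rightarrow> bool" where
  "mp_system G M T \<longleftrightarrow>
     standard_borel M \<and> prob_space M \<and> group_action G (space M) T \<and>
     (\<forall>g\<in>carrier G. T g \<in> M \<rightarrow>\<^sub>M M \<and> distr M M (T g) = M)"

definition is_factor ::
  "('g, 'b) monoid_scheme \<Rightarrow> 'c measure \<Rightarrow> ('g \<Rightarrow> 'c \<Rightarrow> 'c) \<Rightarrow>
   'a measure \<Rightarrow> ('g \<Rightarrow> 'a \<Rightarrow> 'a) \<Rightarrow> bool" where
  "is_factor G N S M T \<longleftrightarrow>
     (\<exists>\<pi> \<in> M \<rightarrow>\<^sub>M N. (AE z in M. \<forall>g\<in>carrier G. \<pi> (T g z) = S g (\<pi> z)) \<and> distr M N \<pi> = N)"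

definition isomorphic_systems ::
  "('g, 'b) monoid_scheme \<Rightarrow> 'a measure \<Rightarrow> ('g \<Rightarrow> 'a \<Rightarrow> 'a) \<Rightarrow>
   'c measure \<Rightarrow> ('g \<Rightarrow> 'c \<Rightarrow> 'c) \<Rightarrow> bool" where
  "isomorphic_systems G M T N S \<longleftrightarrow>
     (\<exists>f \<in> M \<rightarrow>\<^sub>M N. bij_betw f (space M) (space N) \<and> inv_into (space M) f \<in> N \<rightarrow>\<^sub>M M \<and>
        distr M N f = N \<and> (\<forall>g\<in>carrier G. \<forall>x\<in>space M. f (T g x) = S g (f x)))"

definition product_action ::
  "nat set \<Rightarrow> (nat \<Rightarrow> 'a measure) \<Rightarrow> (nat \<Rightarrow> 'g \<Rightarrow> 'a \<Rightarrow> 'a) \<Rightarrow>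
   'g \<Rightarrow> (nat \<Rightarrow> 'a) \<Rightarrow> (nat \<Rightarrow> 'a)" where
  "product_action I Ms Ts g = (\<lambda>x\<in>space (PiM I Ms). \<lambda>i\<in>I. Ts i g (x i))"

definition is_joining ::
  "('g, 'b) monoid_scheme \<Rightarrow> nat set \<Rightarrow> (nat \<Rightarrow> 'a measure) \<Rightarrow> (nat \<Rightarrow> 'g \<Rightarrow> 'a \<Rightarrow> 'a) \<Rightarrow>
   (nat \<Rightarrow> 'a) measure \<Rightarrow> bool" where
  "is_joining G I Ms Ts L \<longleftrightarrow>
     prob_space L \<and> sets L = sets (PiM I Ms) \<and>
     (\<forall>g\<in>carrier G. distr L L (product_action I Ms Ts g) = L) \<and>
     (\<forall>i\<in>I. distr L (Ms i) (\<lambda>x. x i) = Ms i)"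

text \<open>
  A class of systems is represented by its members whose points are real numbers.  Their carrier may
  be any subset of the reals, with any standard Borel structure on it.  Every standard Borel space
  has at most continuum many points, so every system is isomorphic, by a mere relabelling of its
  points, to one of this form; and a class closed under factors is closed under isomorphism, so it
  is determined by these members.  A system on another type belongs to the class iff it
  is isomorphic to one of them.
\<close>

type_synonym 'g system_class = "(real measure \<times> ('g \<Rightarrow> real \<Rightarrow> real)) set"

definition in_class ::
  "('g, 'b) monoid_scheme \<Rightarrow> 'g system_class \<Rightarrow> 'a measure \<Rightarrow> ('g \<Rightarrow> 'a \<Rightarrow> 'a) \<Rightarrow> bool" where
  "in_class G \<C> M T \<longleftrightarrow> (\<exists>(N, S)\<in>\<C>. isomorphic_systems G M T N S)"

text \<open>
  Only nonempty families are joined here, so the empty class is allowed; any nonempty class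
  contains the one-point system as a factor of its members.
\<close>

definition characteristic_class :: "('g, 'b) monoid_scheme \<Rightarrow> 'g system_class \<Rightarrow> bool" where
  "characteristic_class G \<C> \<longleftrightarrow>
     (\<forall>(M, T)\<in>\<C>. mp_system G M T) \<and>
     (\<forall>(M, T)\<in>\<C>. \<forall>N S. mp_system G N S \<and> is_factor G N S M T \<longrightarrow> (N, S) \<in> \<C>) \<and>
     (\<forall>I Ms Ts L. I \<noteq> {} \<and> (\<forall>i\<in>I. (Ms i, Ts i) \<in> \<C>) \<and> is_joining G I Ms Ts L \<longrightarrow>
        in_class G \<C> L (product_action I Ms Ts))"

definition invariant_measures ::
  "('g, 'b) monoid_scheme \<Rightarrow> 'x::metric_space set \<Rightarrow> ('g \<Rightarrow> 'x \<Rightarrow> 'x) \<Rightarrow> 'x measure set" where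
  "invariant_measures G X \<phi> =
     {M. prob_space M \<and> sets M = sets (restrict_space borel X) \<and>
         (\<forall>g\<in>carrier G. distr M M (\<phi> g) = M)}"

definition ergodic ::
  "('g, 'b) monoid_scheme \<Rightarrow> ('g \<Rightarrow> 'x \<Rightarrow> 'x) \<Rightarrow> 'x measure \<Rightarrow> bool" where
  "ergodic G \<phi> M \<longleftrightarrow>
     (\<forall>A\<in>sets M. (\<forall>g\<in>carrier G. \<phi> g -` A \<inter> space M = A) \<longrightarrow> measure M A = 0 \<or> measure M A = 1)"

definition joinings ::
  "('g, 'b) monoid_scheme \<Rightarrow> ('g \<Rightarrow> 'x \<Rightarrow> 'x) \<Rightarrow> 'x measure \<Rightarrow> 'x measure \<Rightarrow> ('x \<times> 'x) measure set" where
  "joinings G \<phi> M N =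
     {L. prob_space L \<and> sets L = sets (M \<Otimes>\<^sub>M N) \<and>
         (\<forall>g\<in>carrier G. distr L L (\<lambda>(x, z). (\<phi> g x, \<phi> g z)) = L) \<and>
         distr L M fst = M \<and> distr L N snd = N}"

text \<open>
  The locale \<open>Metric_space\<close> asks for nonnegativity and symmetry on the whole type, hence the value
  \<open>0\<close> outside the invariant measures.
\<close>

definition rho_bar ::
  "('g, 'b) monoid_scheme \<Rightarrow> 'x::metric_space set \<Rightarrow> ('g \<Rightarrow> 'x \<Rightarrow> 'x) \<Rightarrow>
   'x measure \<Rightarrow> 'x measure \<Rightarrow> real" where
  "rho_bar G X \<phi> M N =
     (if M \<in> invariant_measures G X \<phi> \<and> N \<in> invariant_measures G X \<phi>
      then INF L\<in>joinings G \<phi> M N. \<integral>p. dist (fst p) (snd p) \<partial>L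
      else 0)"

definition ergodic_class_measures ::
  "('g, 'b) monoid_scheme \<Rightarrow> 'x::metric_space set \<Rightarrow> ('g \<Rightarrow> 'x \<Rightarrow> 'x) \<Rightarrow> 'g system_class \<Rightarrow>
   'x measure set" where
  "ergodic_class_measures G X \<phi> \<C> =
     {M \<in> invariant_measures G X \<phi>. ergodic G \<phi> M \<and> in_class G \<C> M \<phi>}"

end

theory Submission
  imports Defs
begin

text \<open>
  Let \<open>\<mu>\<close> be a \<open>\<rho>\<close>-bar limit of ergodic measures \<open>\<nu>\<^sub>n\<close> of the class, with joinings \<open>\<lambda>\<^sub>n\<close> of \<open>\<mu>\<close> and \<open>\<nu>\<^sub>n\<close>
  of summable cost.

  Ergodicity: if \<open>A\<close> is invariant, then \<open>E \<mapsto> \<lambda>\<^sub>n (A \<times> E)\<close> is invariant and absolutely continuous with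
  respect to the ergodic measure \<open>\<nu>\<^sub>n\<close>, hence equal to \<open>\<mu> A\<close> times \<open>\<nu>\<^sub>n\<close>.  Testing against Lipschitz functions,
  this independence passes to the limit and shows that \<open>A\<close> is independent of itself under \<open>\<mu>\<close>.

  Membership in the class: glue all \<open>\<lambda>\<^sub>n\<close> over \<open>\<mu>\<close>, relatively independently.  In the resulting
  invariant measure the second coordinates form a joining of the \<open>\<nu>\<^sub>n\<close>, and by Borel-Cantelli they converge
  almost surely to the first coordinate.  Hence \<open>\<mu>\<close> is a factor of that joining.  The gluing is
  obtained without disintegration theorems, by writing every \<open>\<lambda>\<^sub>n\<close> as the law of \<open>(x, H\<^sub>n x u)\<close> with \<open>u\<close>
  uniform and independent of \<open>x\<close>; the same gluing gives the triangle inequality for the metric.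
\<close>

section \<open>Compact metric spaces as measurable spaces\<close>

text \<open>The main obstacle is that conditional objects are determined only up to null sets. The
  maps \<open>H n\<close> have no reason to be equivariant, and they are not made so. For each fixed
  measurable \<open>E\<close>, the conditional probability of \<open>E\<close> given the first
  coordinate is a Radon-Nikodym density, and invariance of the joining makes it equivariant almost
  everywhere. This is enough, because the law of the glued sequence is determined on finite
  cylinders, where it is the integral of a finite product of such probabilities. In the ergodicity
  argument the density is again invariant only almost everywhere, one group element at a time,
  whereas \<open>ergodic\<close> speaks of strictly invariant sets; a supremum over the countable
  group repairs this. A second obstacle is that the class contains systems on the reals only, so the
  limit measure needs a real model of its own. The isomorphism chosen for the first approximating
  measure supplies it, being a Borel bijection on all of \<open>X\<close> that commutes with the
  action everywhere.\<close>

lemma compact_dense_sequence: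
  fixes X :: "'a::metric_space set"
  assumes "compact X" "X \<noteq> {}"
  obtains D :: "nat \<Rightarrow> 'a" where "\<And>n. D n \<in> X" "\<And>x e. x \<in> X \<Longrightarrow> 0 < e \<Longrightarrow> \<exists>n. dist (D n) x < e"
proof -
  have "\<exists>C. C \<subseteq> X \<and> finite C \<and> X \<subseteq> (\<Union>c\<in>C. ball c (1 / real (Suc n)))" for n
  proof -
    have "X \<subseteq> (\<Union>c\<in>X. ball c (1 / real (Suc n)))"
      by force
    from compactE_image[OF assms(1) open_ball this] show ?thesis
      by metis
  qed
  then obtain C where C: "\<And>n. C n \<subseteq> X" "\<And>n. finite (C n)"
      "\<And>n. X \<subseteq> (\<Union>c\<in>C n. ball c (1 / real (Suc n)))"
    by metis
  define S where "S = (\<Union>n. C n)"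
  have "countable S"
    unfolding S_def using C(2) by (simp add: countable_finite)
  have ne: "S \<noteq> {}"
    using C(3)[of 0] assms(2) unfolding S_def by fastforce
  show thesis
  proof
    show "from_nat_into S n \<in> X" for n
      using from_nat_into[OF ne, of n] C(1) unfolding S_def by blast
    fix x and e :: real
    assume x: "x \<in> X" and "0 < e"
    then obtain n where n: "1 / real (Suc n) < e"
      using nat_approx_posE by metis
    obtain c where c: "c \<in> C n" "dist c x < 1 / real (Suc n)"
      using C(3)[of n] x by auto
    then have "c \<in> S"
      by (auto simp: S_def)
    then obtain k where "from_nat_into S k = c"
      using from_nat_into_surj[OF \<open>countable S\<close>] by blast
    then show "\<exists>n. dist (from_nat_into S n) x < e"
      using c n by (metis less_trans)
  qed
qed

text \<open>The ambient type need not be second countable, so continuity of the distance does not by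
  itself give measurability for the product sigma-algebra. An infimum over a dense sequence of sums
  of one-variable functions does.\<close>

lemma measurable_dist_compact:
  fixes X :: "'a::metric_space set"
  assumes "compact X"
  shows "(\<lambda>p. dist (fst p) (snd p)) \<in> borel_measurable (restrict_space borel X \<Otimes>\<^sub>M restrict_space borel X)"
proof (cases "X = {}")
  case True
  then show ?thesis
    by (auto simp: measurable_def space_pair_measure space_restrict_space)
next
  case False
  let ?B = "restrict_space borel X"
  obtain D :: "nat \<Rightarrow> 'a" where D: "\<And>n. D n \<in> X" "\<And>x e. x \<in> X \<Longrightarrow> 0 < e \<Longrightarrow> \<exists>n. dist (D n) x < e"
    using compact_dense_sequence[OF assms False] by blast
  have m: "(\<lambda>x. dist x y) \<in> borel_measurable ?B" for y
    by (intro borel_measurable_continuous_on_restrict continuous_intros)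
  have "dist (fst p) (snd p) = (INF n. dist (fst p) (D n) + dist (snd p) (D n))"
    if p: "p \<in> space (?B \<Otimes>\<^sub>M ?B)" for p
  proof (rule antisym)
    show "dist (fst p) (snd p) \<le> (INF n. dist (fst p) (D n) + dist (snd p) (D n))"
      by (intro cINF_greatest) (auto simp: dist_triangle2)
    have bdd: "bdd_below (range (\<lambda>n. dist (fst p) (D n) + dist (snd p) (D n)))"
      by (intro bdd_belowI[of _ 0]) auto
    show "(INF n. dist (fst p) (D n) + dist (snd p) (D n)) \<le> dist (fst p) (snd p)"
    proof (rule field_le_epsilon)
      fix e :: real assume "0 < e"
      then obtain n where n: "dist (D n) (fst p) < e / 2"
        using D(2)[of "fst p" "e / 2"] p by (auto simp: space_pair_measure space_restrict_space)
      have "(INF n. dist (fst p) (D n) + dist (snd p) (D n)) \<le> dist (fst p) (D n) + dist (snd p) (D n)"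
        by (rule cINF_lower[OF bdd]) simp
      also have "\<dots> \<le> dist (fst p) (snd p) + e"
        using n dist_triangle[of "snd p" "D n" "fst p"] by (simp add: dist_commute)
      finally show "(INF n. dist (fst p) (D n) + dist (snd p) (D n)) \<le> dist (fst p) (snd p) + e" .
    qed
  qed
  moreover have "(\<lambda>p. INF n. dist (fst p) (D n) + dist (snd p) (D n)) \<in> borel_measurable (?B \<Otimes>\<^sub>M ?B)"
    by (intro borel_measurable_cINF_real borel_measurable_add measurable_compose[OF measurable_fst m]
        measurable_compose[OF measurable_snd m]) auto
  ultimately show ?thesis
    by (subst measurable_cong) auto
qed

lemma measurable_Cauchy_compact:
  fixes X :: "'a::metric_space set"
  assumes "compact X" and [measurable]: "\<And>n::nat. f n \<in> M \<rightarrow>\<^sub>M restrict_space borel X"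
  shows "Measurable.pred M (\<lambda>w. Cauchy (\<lambda>n. f n w))"
proof -
  have d [measurable]: "(\<lambda>w. dist (f m w) (f n w)) \<in> borel_measurable M" for m n
  proof -
    have "(\<lambda>w. (f m w, f n w)) \<in> M \<rightarrow>\<^sub>M restrict_space borel X \<Otimes>\<^sub>M restrict_space borel X"
      by measurable
    from measurable_compose[OF this measurable_dist_compact[OF assms(1)]] show ?thesis
      by simp
  qed
  have "Measurable.pred M (\<lambda>w. \<forall>j. \<exists>K. \<forall>m\<ge>K. \<forall>n\<ge>K. dist (f m w) (f n w) < inverse (real (Suc j)))"
    by measurable
  then show ?thesis
    by (simp add: metric_Cauchy_iff2)
qed

text \<open>Outside of Cauchy sequences the value is an arbitrary point of \<open>X\<close>, so that \<open>lim_in X\<close> maps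
  sequences in a compact \<open>X\<close> into \<open>X\<close>.\<close>

definition lim_in :: "'a::metric_space set \<Rightarrow> (nat \<Rightarrow> 'a) \<Rightarrow> 'a" where
  "lim_in X s = (if Cauchy s then lim s else (SOME x. x \<in> X))"

lemma lim_in_eq: "s \<longlonglongrightarrow> x \<Longrightarrow> lim_in X s = x"
  by (simp add: lim_in_def LIMSEQ_imp_Cauchy limI)

lemma lim_in_tendsto:
  assumes "compact X" "\<And>n. s n \<in> X" "Cauchy s"
  shows "s \<longlonglongrightarrow> lim_in X s" "lim_in X s \<in> X"
proof -
  obtain l where "l \<in> X" "s \<longlonglongrightarrow> l"
    using compact_imp_complete[OF assms(1)] assms(2,3) unfolding complete_def by blast
  moreover from this have "lim_in X s = l"
    by (intro lim_in_eq)
  ultimately show "s \<longlonglongrightarrow> lim_in X s" "lim_in X s \<in> X"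
    by simp_all
qed

lemma lim_in_mem:
  assumes "compact X" "\<And>n. s n \<in> X"
  shows "lim_in X s \<in> X"
proof (cases "Cauchy s")
  case False
  then show ?thesis
    using someI[of "\<lambda>x. x \<in> X", OF assms(2)] by (simp add: lim_in_def)
qed (use lim_in_tendsto[OF assms] in auto)

text \<open>Replacing the sequence by a constant off the measurable Cauchy event makes it converge
  everywhere, so \<open>lim_in\<close> becomes a pointwise limit of measurable functions.\<close>

lemma measurable_lim_in:
  fixes X :: "'a::metric_space set"
  assumes "compact X" and f: "\<And>n. f n \<in> M \<rightarrow>\<^sub>M restrict_space borel X"
  shows "(\<lambda>w. lim_in X (\<lambda>n. f n w)) \<in> M \<rightarrow>\<^sub>M restrict_space borel X"
proof -
  let ?x = "SOME x. x \<in> X"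
  have fX: "f n w \<in> X" if "w \<in> space M" for n w
    using measurable_space[OF f that] by (simp add: space_restrict_space)
  have [measurable]: "Measurable.pred M (\<lambda>w. Cauchy (\<lambda>n. f n w))"
    by (rule measurable_Cauchy_compact[OF assms(1) f])
  have "(\<lambda>w. lim_in X (\<lambda>n. f n w)) \<in> borel_measurable M"
  proof (rule borel_measurable_LIMSEQ_metric)
    have [measurable]: "f n \<in> borel_measurable M" for n
      using f by (simp add: measurable_restrict_space2_iff)
    show "(\<lambda>w. if Cauchy (\<lambda>n. f n w) then f n w else ?x) \<in> borel_measurable M" for n
      by measurable
    fix w assume w: "w \<in> space M"
    show "(\<lambda>n. if Cauchy (\<lambda>n. f n w) then f n w else ?x) \<longlonglongrightarrow> lim_in X (\<lambda>n. f n w)"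
      using lim_in_tendsto(1)[OF assms(1) fX[OF w]] by (auto simp: lim_in_def)
  qed
  moreover have "(\<lambda>w. lim_in X (\<lambda>n. f n w)) \<in> space M \<rightarrow> X"
    by (intro Pi_I lim_in_mem[OF assms(1)] fX)
  ultimately show ?thesis
    by (simp add: measurable_restrict_space2_iff)
qed

section \<open>Borel coding of the points of \<open>X\<close> by reals in the unit interval\<close>

text \<open>With digits \<open>1\<close> and \<open>2\<close> only, all tails of a base-4 expansion lie in \<open>[1/3, 2/3]\<close>, so the digits can be
  read off with the floor function.\<close>

lemma base4_digit:
  fixes c :: "nat \<Rightarrow> int"
  assumes "\<And>n. c n \<in> {1, 2}"
  defines "s \<equiv> \<Sum>n. of_int (c n) / (4::real) ^ Suc n"
  shows "\<lfloor>4 ^ Suc n * s\<rfloor> mod 4 = c n" and "0 < s" "s < 1"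
proof -
  define T where "T n = (\<Sum>i. of_int (c (n + i)) / (4::real) ^ Suc i)" for n
  \<comment> \<open>A constant digit \<open>a\<close> has tail \<open>a / 3\<close>; the digits 1
    and 2 give the two extreme tails.\<close>
  have geo: "(\<lambda>i. a / (4::real) ^ Suc i) sums (a / 3)" for a
  proof -
    have "(\<lambda>i. (a / 4) * (1 / 4::real) ^ i) sums ((a / 4) * (1 / (1 - 1 / 4)))"
      by (intro sums_mult geometric_sums) simp
    then show ?thesis
      by (simp add: power_one_over field_simps)
  qed
  have c: "1 \<le> c n" "c n \<le> 2" for n
    using assms(1)[of n] by auto
  have sm: "summable (\<lambda>i. of_int (c (n + i)) / (4::real) ^ Suc i)" for n
  proof (rule summable_comparison_test[OF _ sums_summable[OF geo[of 2]]], intro exI allI impI)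
    fix i show "norm (of_int (c (n + i)) / (4::real) ^ Suc i) \<le> 2 / 4 ^ Suc i"
      using c[of "n + i"] by (simp add: divide_right_mono del: power_Suc)
  qed
  have digit_bounds: "1 / 4 ^ Suc i \<le> of_int (c j) / (4::real) ^ Suc i" "of_int (c j) / (4::real) ^ Suc i \<le> 2 / 4 ^ Suc i"
    for i j
    using c[of j] by (simp_all add: divide_right_mono del: power_Suc)
  have T_lo: "1 / 3 \<le> T n" for n
    unfolding T_def by (rule sums_le[OF digit_bounds(1) geo[of 1] summable_sums[OF sm]])
  have T_hi: "T n \<le> 2 / 3" for n
    unfolding T_def by (rule sums_le[OF digit_bounds(2) summable_sums[OF sm] geo[of 2]])
  have step: "4 * T n = of_int (c n) + T (Suc n)" for n
  proof -
    have "T n = of_int (c n) / 4 + (\<Sum>i. of_int (c (n + Suc i)) / (4::real) ^ Suc (Suc i))"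
      unfolding T_def using suminf_split_head[OF sm[of n]] by simp
    also have "(\<Sum>i. of_int (c (n + Suc i)) / (4::real) ^ Suc (Suc i)) = T (Suc n) / 4"
      unfolding T_def using suminf_divide[OF sm[of "Suc n"], of 4] by (simp add: mult.commute)
    finally show ?thesis by simp
  qed
  \<comment> \<open>The integer \<open>k\<close> collects the first \<open>n\<close> digits, and the
    rescaled tail \<open>T n\<close> is the fractional part.\<close>
  have ex: "\<exists>k::int. 4 ^ n * s = of_int k + T n" for n
  proof (induction n)
    case 0
    show ?case by (intro exI[of _ 0]) (simp add: s_def T_def)
  next
    case (Suc n)
    then obtain k :: int where "4 ^ n * s = of_int k + T n" by blast
    then have "4 ^ Suc n * s = of_int (4 * k + c n) + T (Suc n)"
      using step[of n] by simp
    then show ?case by blast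
  qed
  obtain k :: int where k: "4 ^ n * s = of_int k + T n"
    using ex by blast
  have "4 ^ Suc n * s = of_int (4 * k + c n) + T (Suc n)"
    using k step[of n] by simp
  then have "\<lfloor>4 ^ Suc n * s\<rfloor> = 4 * k + c n"
    using T_lo[of "Suc n"] T_hi[of "Suc n"] by (intro floor_unique) auto
  then show "\<lfloor>4 ^ Suc n * s\<rfloor> mod 4 = c n"
    using c[of n] by simp
  show "0 < s" "s < 1"
    using T_lo[of 0] T_hi[of 0] by (simp_all add: s_def T_def)
qed

text \<open>A point is coded by the answers to countably many questions, whether it lies within
  \<open>1 / Suc k\<close> of the dense point \<open>D j\<close>, with digit 2 for yes. Decoding
  takes, for each \<open>k\<close>, the first close dense point and passes to the limit. That
  \<open>r\<close> is Borel on the whole line matters: later it is applied to quantiles that need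
  not be codes, and no measurability of the image of \<open>e\<close> enters.\<close>

lemma compact_real_embedding:
  fixes X :: "'a::metric_space set"
  assumes "compact X" "X \<noteq> {}"
  obtains e :: "'a \<Rightarrow> real" and r where
    "e \<in> borel_measurable (restrict_space borel X)" "r \<in> borel \<rightarrow>\<^sub>M restrict_space borel X"
    "\<And>x. x \<in> X \<Longrightarrow> r (e x) = x" "\<And>x. x \<in> X \<Longrightarrow> e x \<in> {0<..<1}"
proof -
  let ?B = "restrict_space borel X"
  obtain D :: "nat \<Rightarrow> 'a" where D: "\<And>n. D n \<in> X" "\<And>x e. x \<in> X \<Longrightarrow> 0 < e \<Longrightarrow> \<exists>n. dist (D n) x < e"
    using compact_dense_sequence[OF assms] by blast
  define near where "near j k x \<longleftrightarrow> dist (D j) x < 1 / real (Suc k)" for j k x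
  define c where "c i x = (if near (fst (prod_decode i)) (snd (prod_decode i)) x then 2 else 1 :: int)" for i x
  define e where "e x = (\<Sum>i. of_int (c i x) / (4::real) ^ Suc i)" for x
  define dig where "dig n y = \<lfloor>4 ^ Suc n * y\<rfloor> mod 4" for n and y :: real
  \<comment> \<open>If \<open>y\<close> codes no point, the \<open>LEAST\<close> may be an arbitrary
    index, but every \<open>D j\<close> lies in \<open>X\<close>, so \<open>r\<close> still takes
    its values in \<open>X\<close>.\<close>
  define r where "r y = lim_in X (\<lambda>k. D (LEAST j. dig (prod_encode (j, k)) y = 2))" for y
  have c12: "c i x \<in> {1, 2}" for i x
    by (simp add: c_def)
  have dig: "dig (prod_encode (j, k)) (e x) = 2 \<longleftrightarrow> near j k x" for j k x
    using base4_digit(1)[of "\<lambda>i. c i x" "prod_encode (j, k)", OF c12]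
    by (simp add: dig_def e_def c_def)
  have m: "(\<lambda>x. dist y x) \<in> borel_measurable ?B" for y
    by (intro borel_measurable_continuous_on_restrict continuous_intros)
  show thesis
  proof
    note [measurable] = m
    have [measurable]: "(\<lambda>x. of_int (c i x)::real) \<in> borel_measurable ?B" for i
      unfolding c_def near_def by measurable
    show "e \<in> borel_measurable ?B"
      unfolding e_def by measurable
    have [measurable]: "Measurable.pred borel (\<lambda>y. dig n y = 2)" for n
      unfolding dig_def by measurable
    have D': "D \<in> count_space UNIV \<rightarrow>\<^sub>M ?B"
      using D(1) by (simp add: space_restrict_space)
    show "r \<in> borel \<rightarrow>\<^sub>M ?B"
      unfolding r_def
      by (intro measurable_lim_in[OF assms(1)] measurable_compose[OF _ D']) measurable
    fix x assume x: "x \<in> X"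
    show "e x \<in> {0<..<1}"
      using base4_digit(2,3)[of "\<lambda>i. c i x", OF c12] by (simp add: e_def)
    have "near (LEAST j. near j k x) k x" for k
      by (rule LeastI_ex) (use D(2)[OF x, of "1 / real (Suc k)"] in \<open>simp add: near_def\<close>)
    then have "dist (D (LEAST j. near j k x)) x < 1 / real (Suc k)" for k
      by (simp add: near_def)
    then have "(\<lambda>k. D (LEAST j. near j k x)) \<longlonglongrightarrow> x"
      by (intro metric_tendsto_imp_tendsto[OF LIMSEQ_inverse_real_of_nat])
        (auto intro!: always_eventually simp: inverse_eq_divide less_imp_le)
    then show "r (e x) = x"
      unfolding r_def dig by (rule lim_in_eq)
  qed
qed

section \<open>Outsourcing of randomness\<close>

definition unit_noise :: "real measure" where
  "unit_noise = uniform_measure lborel {0<..<1}"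

lemma sets_unit_noise [simp, measurable_cong]: "sets unit_noise = sets borel"
  and space_unit_noise [simp]: "space unit_noise = UNIV"
  by (simp_all add: unit_noise_def)

lemma prob_space_unit_noise: "prob_space unit_noise"
  unfolding unit_noise_def by (rule prob_space_uniform_measure) auto

lemma emeasure_unit_noise_less:
  assumes "s \<le> 1"
  shows "emeasure unit_noise {u. ennreal u < s} = s"
proof -
  obtain c where c: "s = ennreal c" "0 \<le> c"
    using assms by (cases s) (auto simp: top_unique)
  have "c \<le> 1"
    using assms c by simp
  have [measurable]: "{u. ennreal u < s} \<in> sets borel"
    by measurable
  \<comment> \<open>\<open>ennreal\<close> sends negative \<open>u\<close> to 0, so the set contains
    negative reals whenever \<open>s\<close> is positive; the support of the noise cuts them
    off.\<close>
  have "{0<..<1} \<inter> {u. ennreal u < s} = {0<..<c}"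
    using c \<open>c \<le> 1\<close> by (auto simp: ennreal_less_iff)
  then show ?thesis
    using c by (simp add: unit_noise_def divide_ennreal_def)
qed

text \<open>Provides an intersection-stable generator, so that a finite measure on the product is
  determined by its conditional distribution functions.\<close>

lemma sets_pair_borel_lessThan:
  "sets (M \<Otimes>\<^sub>M (borel :: real measure)) = sigma_sets (space M \<times> UNIV) {A \<times> {..<t} | A t. A \<in> sets M}"
    (is "_ = sigma_sets ?\<Omega> ?E")
proof (rule antisym)
  interpret S: sigma_algebra ?\<Omega> "sigma_sets ?\<Omega> ?E"
    by (rule sigma_algebra_sigma_sets) (use sets.sets_into_space in blast)
  have rect: "A \<times> B \<in> sigma_sets ?\<Omega> ?E" if A: "A \<in> sets M" and B: "B \<in> sigma_sets UNIV (range lessThan)"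
    for A and B :: "real set"
    using B
  proof induction
    case (Basic B)
    then show ?case using A by blast
  next
    case Empty
    show ?case by (simp add: sigma_sets.Empty)
  next
    case (Compl B)
    \<comment> \<open>The complement of a strip is taken inside \<open>A \<times> UNIV\<close>,
      which is not itself a generator and has to be exhausted by half-lines first.\<close>
    have "A \<times> UNIV = (\<Union>n::nat. A \<times> {..<real n})"
      using reals_Archimedean2 by auto
    also have "\<dots> \<in> sigma_sets ?\<Omega> ?E"
      using A by (intro S.countable_UN) blast
    finally have "A \<times> UNIV - A \<times> B \<in> sigma_sets ?\<Omega> ?E"
      using Compl.IH by (rule S.Diff)
    moreover have "A \<times> UNIV - A \<times> B = A \<times> (UNIV - B)"
      by auto
    ultimately show ?case by simp
  next
    case (Union B)
    have "A \<times> (\<Union>i. B i) = (\<Union>i. A \<times> B i)"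
      by auto
    also have "\<dots> \<in> sigma_sets ?\<Omega> ?E"
      by (rule S.countable_UN) (use Union.IH in auto)
    finally show ?case .
  qed
  have "sets (borel :: real measure) = sigma_sets UNIV (range lessThan)"
    by (subst borel_Iio) (simp add: sets_measure_of)
  then show "sets (M \<Otimes>\<^sub>M (borel :: real measure)) \<subseteq> sigma_sets ?\<Omega> ?E"
    unfolding sets_pair_measure space_borel
    by (intro sigma_sets_mono) (use rect in auto)
  show "sigma_sets ?\<Omega> ?E \<subseteq> sets (M \<Otimes>\<^sub>M (borel :: real measure))"
  proof -
    have "?E \<subseteq> sets (M \<Otimes>\<^sub>M (borel :: real measure))"
      by auto
    from sets.sigma_sets_subset[OF this] show ?thesis
      by (simp add: space_pair_measure)
  qed
qed

section \<open>Conditional probabilities as densities, and fibrewise quantile functions\<close>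

lemma emeasure_Times_le_marginal:
  assumes L: "sets L = sets (M \<Otimes>\<^sub>M N)" "distr L M fst = M"
    and A: "A \<in> sets M"
  shows "emeasure L (A \<times> E) \<le> emeasure M A"
    and "emeasure L (A \<times> space N) = emeasure M A"
proof -
  have [measurable]: "fst \<in> L \<rightarrow>\<^sub>M M"
    using measurable_fst measurable_cong_sets[OF L(1) refl] by blast
  have sp: "space L = space M \<times> space N"
    using sets_eq_imp_space_eq[OF L(1)] by (simp add: space_pair_measure)
  have "emeasure M A = emeasure L (fst -` A \<inter> space L)"
    using emeasure_distr[of fst L M A] A by (simp add: L(2))
  also have "fst -` A \<inter> space L = A \<times> space N"
    using sets.sets_into_space[OF A] sp by auto
  finally show eq: "emeasure L (A \<times> space N) = emeasure M A" ..
  show "emeasure L (A \<times> E) \<le> emeasure M A"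
  proof (cases "A \<times> E \<in> sets L")
    case True
    have "A \<times> space N \<in> sets L"
      using A L(1) by simp
    then show ?thesis
      unfolding eq[symmetric] using sets.sets_into_space[OF True] sp by (intro emeasure_mono) auto
  qed (simp add: emeasure_notin_sets)
qed

text \<open>\<open>F\<close> is the conditional probability of \<open>E\<close> given the first
  coordinate, that is, the Radon-Nikodym derivative of \<open>A \<mapsto> L (A \<times> E)\<close>.
  It is built for one set \<open>E\<close> at a time, so no regular conditional probability is
  required.\<close>

lemma section_density:
  assumes "sigma_finite_measure M" and L: "sets L = sets (M \<Otimes>\<^sub>M N)" "distr L M fst = M"
    and E: "E \<in> sets N"
  obtains F where "F \<in> borel_measurable M"
    "\<And>A. A \<in> sets M \<Longrightarrow> (\<integral>\<^sup>+x\<in>A. F x \<partial>M) = emeasure L (A \<times> E)"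
proof -
  interpret sigma_finite_measure M by fact
  define K where "K = distr (density L (indicator (space M \<times> E))) M fst"
  have [measurable]: "fst \<in> L \<rightarrow>\<^sub>M M"
    using measurable_fst measurable_cong_sets[OF L(1) refl] by blast
  have ME: "space M \<times> E \<in> sets L"
    using E L(1) by simp
  have sp: "space L = space M \<times> space N"
    using sets_eq_imp_space_eq[OF L(1)] by (simp add: space_pair_measure)
  have K: "emeasure K A = emeasure L (A \<times> E)" if A: "A \<in> sets M" for A
  proof -
    have eq: "(space M \<times> E) \<inter> (fst -` A \<inter> space L) = A \<times> E"
      using sets.sets_into_space[OF A] sets.sets_into_space[OF E] sp by auto
    have "emeasure K A = emeasure (density L (indicator (space M \<times> E))) (fst -` A \<inter> space L)"
      unfolding K_def using A by (subst emeasure_distr) auto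
    also have "\<dots> = emeasure L ((space M \<times> E) \<inter> (fst -` A \<inter> space L))"
      using ME A by (intro emeasure_restricted) (auto intro: measurable_sets)
    finally show ?thesis by (simp only: eq)
  qed
  have setsK: "sets K = sets M"
    by (simp add: K_def)
  have "absolutely_continuous M K"
    unfolding absolutely_continuous_def
  proof
    fix A assume A: "A \<in> null_sets M"
    then have "emeasure L (A \<times> E) \<le> 0"
      using emeasure_Times_le_marginal(1)[OF L, of A E] by (auto simp: null_sets_def)
    then show "A \<in> null_sets K"
      using A K[of A] setsK by (auto simp: null_sets_def)
  qed
  from Radon_Nikodym[OF this setsK] obtain F where F: "F \<in> borel_measurable M" "density M F = K"
    by blast
  show thesis
  proof (rule that[OF F(1)])
    fix A assume "A \<in> sets M"
    then show "(\<integral>\<^sup>+x\<in>A. F x \<partial>M) = emeasure L (A \<times> E)"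
      using F K[of A] emeasure_density[of F M A] by simp
  qed
qed

text \<open>This is the quantile transform carried out in each fibre. Monotonicity and the bound 1
  hold only almost everywhere for each pair of thresholds, so only countably many rational
  thresholds are used. Distribution functions are taken over the open half-lines
  \<open>{..<q}\<close>: these increase to \<open>{..<t}\<close> as rationals \<open>q < t\<close>
  increase, so every real threshold is recovered by continuity from below.\<close>

lemma real_noise_outsourcing:
  fixes L :: "('a \<times> real) measure"
  assumes "prob_space M" "prob_space L" and L: "sets L = sets (M \<Otimes>\<^sub>M borel)" "distr L M fst = M"
    and L1: "emeasure L (space M \<times> {0<..<1}) = 1"
  obtains H where "(\<lambda>(x, u). H x u) \<in> borel_measurable (M \<Otimes>\<^sub>M unit_noise)"
    "distr (M \<Otimes>\<^sub>M unit_noise) (M \<Otimes>\<^sub>M borel) (\<lambda>(x, u). (x, H x u)) = L"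
proof -
  interpret M: prob_space M by fact
  interpret L: prob_space L by fact
  interpret U: prob_space unit_noise by (rule prob_space_unit_noise)
  interpret MU: pair_prob_space M unit_noise ..
  have "\<exists>F. F \<in> borel_measurable M \<and> (\<forall>A\<in>sets M. (\<integral>\<^sup>+x\<in>A. F x \<partial>M) = emeasure L (A \<times> {..<q}))" for q
    by (rule section_density[OF M.sigma_finite_measure_axioms L, of "{..<q}"]) auto
  then obtain F where F [measurable]: "\<And>q. F q \<in> borel_measurable M"
      and int_F: "\<And>q A. A \<in> sets M \<Longrightarrow> (\<integral>\<^sup>+x\<in>A. F q x \<partial>M) = emeasure L (A \<times> {..<q})"
    by metis
  have rect: "A \<times> E \<in> sets L" if "A \<in> sets M" "E \<in> sets borel" for A and E :: "real set"
    using that L(1) by simp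
  \<comment> \<open>Additivity over disjoint sets, by uniqueness of densities. Monotonicity in
    \<open>q\<close> and the bound 1 come from \<open>E = {p..<q}\<close> and
    \<open>E = {p..}\<close>.\<close>
  have F_add: "AE x in M. F p x + D x = F' x"
    if D: "D \<in> borel_measurable M" "\<And>A. A \<in> sets M \<Longrightarrow> (\<integral>\<^sup>+x\<in>A. D x \<partial>M) = emeasure L (A \<times> E)"
      and F': "F' \<in> borel_measurable M" "\<And>A. A \<in> sets M \<Longrightarrow> (\<integral>\<^sup>+x\<in>A. F' x \<partial>M) = emeasure L (A \<times> ({..<p} \<union> E))"
      and E: "E \<in> sets borel" "{..<p} \<inter> E = {}" for p D F' E
  proof (rule M.density_unique2)
    note [measurable] = D(1) F'(1)
    show "(\<lambda>x. F p x + D x) \<in> borel_measurable M" "F' \<in> borel_measurable M"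
      by measurable
    fix A assume A [measurable]: "A \<in> sets M"
    have "(\<integral>\<^sup>+x\<in>A. (F p x + D x) \<partial>M) = (\<integral>\<^sup>+x\<in>A. F p x \<partial>M) + (\<integral>\<^sup>+x\<in>A. D x \<partial>M)"
      by (subst nn_integral_add[symmetric]) (auto simp: distrib_right)
    also have "\<dots> = emeasure L (A \<times> {..<p}) + emeasure L (A \<times> E)"
      by (simp add: int_F[OF A] D(2)[OF A])
    also have "\<dots> = emeasure L (A \<times> {..<p} \<union> A \<times> E)"
      using E rect[OF A] by (intro plus_emeasure) auto
    also have "A \<times> {..<p} \<union> A \<times> E = A \<times> ({..<p} \<union> E)"
      by auto
    finally show "(\<integral>\<^sup>+x\<in>A. (F p x + D x) \<partial>M) = (\<integral>\<^sup>+x\<in>A. F' x \<partial>M)"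
      by (simp add: F'(2)[OF A])
  qed
  have F_mono: "AE x in M. F p x \<le> F q x" if "p \<le> q" for p q
  proof -
    obtain D where D: "D \<in> borel_measurable M" "\<And>A. A \<in> sets M \<Longrightarrow> (\<integral>\<^sup>+x\<in>A. D x \<partial>M) = emeasure L (A \<times> {p..<q})"
      using section_density[OF M.sigma_finite_measure_axioms L, of "{p..<q}"] by auto
    have "{..<p} \<union> {p..<q} = {..<q}"
      using that by auto
    then have "AE x in M. F p x + D x = F q x"
      using D int_F by (intro F_add[of D "{p..<q}"]) auto
    then show ?thesis
      by eventually_elim (metis le_iff_add)
  qed
  have F_le1: "AE x in M. F p x \<le> 1" for p
  proof -
    obtain D where D: "D \<in> borel_measurable M" "\<And>A. A \<in> sets M \<Longrightarrow> (\<integral>\<^sup>+x\<in>A. D x \<partial>M) = emeasure L (A \<times> {p..})"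
      using section_density[OF M.sigma_finite_measure_axioms L, of "{p..}"] by auto
    have "{..<p} \<union> {p..} = UNIV"
      by auto
    then have "AE x in M. F p x + D x = 1"
      using D emeasure_Times_le_marginal(2)[OF L] by (intro F_add[of D "{p..}"]) auto
    then show ?thesis
      by eventually_elim (metis le_iff_add)
  qed
  define Q where "Q = \<rat> \<inter> {0<..<1::real}"
  have [simp]: "countable Q"
    by (simp add: Q_def countable_rat countable_Int1)
  have AE_Q: "AE x in M. (\<forall>q\<in>Q. F q x \<le> 1) \<and> (\<forall>p\<in>Q. \<forall>q\<in>Q. p \<le> q \<longrightarrow> F p x \<le> F q x)"
    using F_mono F_le1 by (auto simp: AE_ball_countable)
  \<comment> \<open>\<open>F q x\<close> is the conditional distribution function at \<open>q\<close>, and \<open>H x\<close> its quantile function.\<close>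
  define H where "H x u = Inf (insert 1 {q\<in>Q. ennreal u < F q x})" for x u
  \<comment> \<open>The inserted 1 keeps the infimum over a nonempty set even if no threshold
    qualifies. With strict inequalities, \<open>H x u < t\<close> becomes a countable disjunction,
    which gives measurability at once.\<close>
  have H_less: "H x u < t \<longleftrightarrow> 1 < t \<or> (\<exists>q\<in>Q. q < t \<and> ennreal u < F q x)" for x u t
    unfolding H_def
    by (subst cInf_less_iff) (auto intro!: bdd_belowI[of _ 0] simp: Q_def)
  have H_meas: "(\<lambda>(x, u). H x u) \<in> borel_measurable (M \<Otimes>\<^sub>M unit_noise)"
    unfolding borel_measurable_iff_less
  proof
    fix t
    have "Measurable.pred (M \<Otimes>\<^sub>M unit_noise) (\<lambda>p. 1 < t \<or> (\<exists>q\<in>Q. q < t \<and> ennreal (snd p) < F q (fst p)))"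
      by measurable
    from predE[OF this]
    show "{p \<in> space (M \<Otimes>\<^sub>M unit_noise). (case p of (x, u) \<Rightarrow> H x u) < t} \<in> sets (M \<Otimes>\<^sub>M unit_noise)"
      unfolding case_prod_beta H_less .
  qed
  let ?f = "\<lambda>(x, u). (x, H x u)"
  have f_meas: "?f \<in> M \<Otimes>\<^sub>M unit_noise \<rightarrow>\<^sub>M M \<Otimes>\<^sub>M borel"
    using H_meas by (simp add: case_prod_beta)
  let ?L' = "distr (M \<Otimes>\<^sub>M unit_noise) (M \<Otimes>\<^sub>M borel) ?f"
  have key: "emeasure ?L' (A \<times> {..<t}) = emeasure L (A \<times> {..<t})" if A [measurable]: "A \<in> sets M" for A t
  proof -
    have "emeasure ?L' (A \<times> {..<t}) = emeasure (M \<Otimes>\<^sub>M unit_noise) (?f -` (A \<times> {..<t}) \<inter> space (M \<Otimes>\<^sub>M unit_noise))"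
      using f_meas by (intro emeasure_distr) auto
    also have "?f -` (A \<times> {..<t}) \<inter> space (M \<Otimes>\<^sub>M unit_noise) = {p \<in> space (M \<Otimes>\<^sub>M unit_noise). fst p \<in> A \<and> H (fst p) (snd p) < t}"
      using sets.sets_into_space[OF A] by (auto simp: space_pair_measure)
    also have "emeasure (M \<Otimes>\<^sub>M unit_noise) \<dots> = (\<integral>\<^sup>+x. emeasure unit_noise (Pair x -` \<dots>) \<partial>M)"
    proof (rule U.emeasure_pair_measure_alt)
      have [measurable]: "(\<lambda>p. H (fst p) (snd p)) \<in> borel_measurable (M \<Otimes>\<^sub>M unit_noise)"
        using H_meas by (simp add: case_prod_beta)
      show "{p \<in> space (M \<Otimes>\<^sub>M unit_noise). fst p \<in> A \<and> H (fst p) (snd p) < t} \<in> sets (M \<Otimes>\<^sub>M unit_noise)"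
        by measurable
    qed
    also have "\<dots> = (\<integral>\<^sup>+x\<in>A. emeasure unit_noise {u. H x u < t} \<partial>M)"
      by (intro nn_integral_cong) (auto simp: space_pair_measure indicator_def vimage_def)
    finally have L': "emeasure ?L' (A \<times> {..<t}) = (\<integral>\<^sup>+x\<in>A. emeasure unit_noise {u. H x u < t} \<partial>M)" .
    \<comment> \<open>For \<open>t \<le> 0\<close> and \<open>1 < t\<close> both sides are forced,
      because \<open>L\<close> is concentrated on second coordinates in the open unit interval. Only
      the middle case needs the conditional distribution functions.\<close>
    consider "t \<le> 0" | "0 < t" "t \<le> 1" | "1 < t" by linarith
    then show ?thesis
    proof cases
      case 1
      then have "{u. H x u < t} = {}" for x
        by (auto simp: H_less Q_def)
      moreover have "emeasure L (A \<times> {..<t}) = 0"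
      proof -
        have "AE p in L. p \<in> space M \<times> {0<..<1}"
          using L1 by (intro L.AE_in_set_eq_1[THEN iffD2]) (auto simp: L(1) measure_def)
        then have "AE p in L. p \<notin> A \<times> {..<t}"
          by (rule AE_mp) (use 1 in auto)
        then show ?thesis
          by (subst (asm) AE_iff_measurable[OF rect[OF A, of "{..<t}"]])
             (use sets.sets_into_space[OF rect[OF A, of "{..<t}"]] in auto)
      qed
      ultimately show ?thesis
        unfolding L' by simp
    next
      case 3
      then have "{u. H x u < t} = UNIV" for x
        by (auto simp: H_less)
      moreover have "emeasure L (A \<times> {..<t}) = emeasure L (A \<times> UNIV)"
      proof (rule emeasure_eq_AE)
        have "AE p in L. p \<in> space M \<times> {0<..<1}"
          using L1 by (intro L.AE_in_set_eq_1[THEN iffD2]) (auto simp: L(1) measure_def)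
        then show "AE p in L. (p \<in> A \<times> {..<t}) = (p \<in> A \<times> UNIV)"
          by (rule AE_mp) (use 3 in auto)
      qed (use rect[OF A] in auto)
      ultimately show ?thesis
        unfolding L' using emeasure_Times_le_marginal(2)[OF L A] U.emeasure_space_1 by simp
    next
      case 2
      define Qt where "Qt = {q\<in>Q. q < t}"
      have "countable Qt"
        by (rule countable_subset[of _ Q]) (auto simp: Qt_def)
      obtain q0 where "q0 \<in> \<rat>" "0 < q0" "q0 < t"
        using Rats_dense_in_real[of 0 t] 2 by blast
      then have "q0 \<in> Qt"
        using 2 by (auto simp: Qt_def Q_def)
      then have ne: "Qt \<noteq> {}"
        by blast
      \<comment> \<open>Running maxima of an enumeration give an increasing sequence cofinal in the
        thresholds below \<open>t\<close>, as monotone convergence requires.\<close>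
      define s where "s i = Max (from_nat_into Qt ` {..i})" for i
      have s: "s i \<in> Qt" for i
      proof -
        have "s i \<in> from_nat_into Qt ` {..i}"
          unfolding s_def by (intro Max_in) auto
        then show ?thesis
          using from_nat_into[OF ne] by auto
      qed
      have s_mono: "incseq s"
        unfolding s_def by (intro monoI Max_mono) auto
      have s_cofinal: "\<exists>i. q \<le> s i" if "q \<in> Qt" for q
      proof -
        obtain i where "from_nat_into Qt i = q"
          using from_nat_into_surj[OF \<open>countable Qt\<close> \<open>q \<in> Qt\<close>] by blast
        then show ?thesis
          by (intro exI[of _ i]) (auto simp: s_def intro!: Max_ge)
      qed
      have ae: "AE x in M. emeasure unit_noise {u. H x u < t} = (SUP i. F (s i) x) \<and> incseq (\<lambda>i. F (s i) x)"
        using AE_Q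
      proof (rule AE_mp, intro AE_I2 impI)
        fix x assume x: "(\<forall>q\<in>Q. F q x \<le> 1) \<and> (\<forall>p\<in>Q. \<forall>q\<in>Q. p \<le> q \<longrightarrow> F p x \<le> F q x)"
        have sQ: "s i \<in> Q" for i
          using s[of i] by (simp add: Qt_def)
        have "H x u < t \<longleftrightarrow> (\<exists>i. ennreal u < F (s i) x)" for u
        proof
          assume "H x u < t"
          then obtain q where q: "q \<in> Qt" "ennreal u < F q x"
            using 2 by (auto simp: Qt_def H_less)
          then obtain i where "q \<le> s i"
            using s_cofinal by blast
          then have "F q x \<le> F (s i) x"
            using x q sQ by (auto simp: Qt_def)
          then show "\<exists>i. ennreal u < F (s i) x"
            using q less_le_trans by blast
        next
          assume "\<exists>i. ennreal u < F (s i) x"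
          then show "H x u < t"
            using s by (auto simp: H_less Qt_def)
        qed
        then have "{u. H x u < t} = {u. ennreal u < (SUP i. F (s i) x)}"
          by (simp add: less_SUP_iff)
        moreover have "(SUP i. F (s i) x) \<le> 1"
          using x sQ by (auto intro!: SUP_least)
        ultimately show "emeasure unit_noise {u. H x u < t} = (SUP i. F (s i) x) \<and> incseq (\<lambda>i. F (s i) x)"
          using emeasure_unit_noise_less x sQ s_mono by (auto simp: mono_def)
      qed
      have "(\<integral>\<^sup>+x\<in>A. emeasure unit_noise {u. H x u < t} \<partial>M) = (\<integral>\<^sup>+x. (SUP i. F (s i) x * indicator A x) \<partial>M)"
        using ae by (intro nn_integral_cong_AE) (auto split: split_indicator elim!: AE_mp)
      also have "\<dots> = (SUP i. \<integral>\<^sup>+x. F (s i) x * indicator A x \<partial>M)"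
      proof (rule nn_integral_monotone_convergence_SUP_AE)
        show "AE x in M. F (s i) x * indicator A x \<le> F (s (Suc i)) x * indicator A x" for i
          using ae
        proof eventually_elim
          case (elim x)
          then show ?case
            using incseq_SucD[of "\<lambda>i. F (s i) x" i] by (auto intro!: mult_right_mono)
        qed
      qed measurable
      also have "\<dots> = (SUP i. emeasure L (A \<times> {..<s i}))"
        by (simp add: int_F[OF A])
      also have "\<dots> = emeasure L (\<Union>i. A \<times> {..<s i})"
      proof (rule SUP_emeasure_incseq)
        show "range (\<lambda>i. A \<times> {..<s i}) \<subseteq> sets L"
          using rect[OF A] by auto
        show "incseq (\<lambda>i. A \<times> {..<s i})"
          using s_mono by (auto simp: mono_def intro: less_le_trans)
      qed
      also have "(\<Union>i. A \<times> {..<s i}) = A \<times> {..<t}"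
      proof -
        have "\<exists>i. y < s i" if "y < t" for y
        proof -
          obtain q where q: "q \<in> \<rat>" "max y 0 < q" "q < t"
            using Rats_dense_in_real[of "max y 0" t] \<open>y < t\<close> 2 by auto
          then have "q \<in> Qt"
            using 2 by (auto simp: Qt_def Q_def)
          from s_cofinal[OF this] show ?thesis
            using q by (auto intro: less_le_trans)
        qed
        moreover have "y < t" if "y < s i" for y i
          using s[of i] that by (auto simp: Qt_def)
        ultimately show ?thesis by auto
      qed
      finally show ?thesis
        by (simp add: L')
    qed
  qed
  have "?L' = L"
  proof (rule measure_eqI_generator_eq[where E="{A \<times> {..<t::real} | A t. A \<in> sets M}" and \<Omega>="space M \<times> UNIV"
        and A="\<lambda>n. space M \<times> {..<real n}"])
    show "Int_stable {A \<times> {..<t::real} | A t. A \<in> sets M}"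
    proof (rule Int_stableI, safe)
      fix A B t t' assume "A \<in> sets M" "B \<in> sets M"
      then show "\<exists>C t''. A \<times> {..<t} \<inter> B \<times> {..<t'} = C \<times> {..<t''::real} \<and> C \<in> sets M"
        by (intro exI[of _ "A \<inter> B"] exI[of _ "min t t'"]) auto
    qed
    show "{A \<times> {..<t::real} | A t. A \<in> sets M} \<subseteq> Pow (space M \<times> UNIV)"
      using sets.sets_into_space by blast
    show "emeasure ?L' X = emeasure L X" if "X \<in> {A \<times> {..<t} | A t. A \<in> sets M}" for X
      using that key by auto
    show "sets ?L' = sigma_sets (space M \<times> UNIV) {A \<times> {..<t} | A t. A \<in> sets M}"
      by (simp add: sets_pair_borel_lessThan)
    show "sets L = sigma_sets (space M \<times> UNIV) {A \<times> {..<t} | A t. A \<in> sets M}"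
      by (simp add: sets_pair_borel_lessThan L(1))
    show "range (\<lambda>n. space M \<times> {..<real n}) \<subseteq> {A \<times> {..<t} | A t. A \<in> sets M}"
      by auto
    show "(\<Union>n. space M \<times> {..<real n}) = space M \<times> UNIV"
      using reals_Archimedean2 by auto
    show "emeasure ?L' (space M \<times> {..<real n}) \<noteq> \<infinity>" for n
      by (subst key) (auto simp: less_top[symmetric] L.emeasure_finite)
  qed
  with H_meas show thesis
    by (rule that)
qed

text \<open>The real case is applied to the law of \<open>(x, e y)\<close> and its output is decoded
  by \<open>r\<close>; since \<open>r\<close> undoes \<open>e\<close> on the space of
  \<open>N\<close>, this gives back \<open>L\<close>.\<close>

lemma noise_outsourcing:
  assumes "prob_space M" "prob_space L" and L: "sets L = sets (M \<Otimes>\<^sub>M N)" "distr L M fst = M"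
    and e: "e \<in> borel_measurable N" and r: "r \<in> borel \<rightarrow>\<^sub>M N"
    and re: "\<And>y. y \<in> space N \<Longrightarrow> r (e y) = y" and e01: "\<And>y. y \<in> space N \<Longrightarrow> e y \<in> {0<..<1::real}"
  obtains H where "(\<lambda>(x, u). H x u) \<in> M \<Otimes>\<^sub>M unit_noise \<rightarrow>\<^sub>M N"
    "distr (M \<Otimes>\<^sub>M unit_noise) (M \<Otimes>\<^sub>M N) (\<lambda>(x, u). (x, H x u)) = L"
proof -
  interpret L: prob_space L by fact
  note [measurable] = e r
  note [measurable_cong] = L(1)
  have sp: "space L = space M \<times> space N"
    using sets_eq_imp_space_eq[OF L(1)] by (simp add: space_pair_measure)
  let ?g = "\<lambda>p. (fst p, e (snd p))"
  have g [measurable]: "?g \<in> L \<rightarrow>\<^sub>M M \<Otimes>\<^sub>M borel"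
    by measurable
  let ?L' = "distr L (M \<Otimes>\<^sub>M borel) ?g"
  have 1: "prob_space ?L'"
    by (rule L.prob_space_distr) measurable
  have 2: "distr ?L' M fst = M"
    by (subst distr_distr) (auto simp: comp_def L(2))
  have 3: "emeasure ?L' (space M \<times> {0<..<1}) = 1"
  proof -
    have "?g -` (space M \<times> {0<..<1}) \<inter> space L = space L"
      using e01 by (auto simp: sp)
    then show ?thesis
      by (subst emeasure_distr) (auto simp: L.emeasure_space_1)
  qed
  obtain H where H: "(\<lambda>(x, u). H x u) \<in> borel_measurable (M \<Otimes>\<^sub>M unit_noise)"
      "distr (M \<Otimes>\<^sub>M unit_noise) (M \<Otimes>\<^sub>M borel) (\<lambda>(x, u). (x, H x u)) = ?L'"
    using real_noise_outsourcing[OF assms(1) 1 _ 2 3] by auto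
  have [measurable]: "(\<lambda>p. H (fst p) (snd p)) \<in> borel_measurable (M \<Otimes>\<^sub>M unit_noise)"
    using H(1) by (simp add: case_prod_beta)
  show thesis
  proof
    show "(\<lambda>(x, u). r (H x u)) \<in> M \<Otimes>\<^sub>M unit_noise \<rightarrow>\<^sub>M N"
      by (simp add: case_prod_beta)
    have "distr (M \<Otimes>\<^sub>M unit_noise) (M \<Otimes>\<^sub>M N) (\<lambda>(x, u). (x, r (H x u)))
        = distr (distr (M \<Otimes>\<^sub>M unit_noise) (M \<Otimes>\<^sub>M borel) (\<lambda>(x, u). (x, H x u))) (M \<Otimes>\<^sub>M N) (\<lambda>p. (fst p, r (snd p)))"
      by (subst distr_distr) (auto simp: comp_def case_prod_beta')
    also have "\<dots> = distr L (M \<Otimes>\<^sub>M N) (\<lambda>p. (fst p, r (e (snd p))))"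
      unfolding H(2) by (subst distr_distr) (auto simp: comp_def)
    also have "\<dots> = distr L L (\<lambda>p. p)"
      using L(1) re by (intro distr_cong) (auto simp: sp)
    finally show "distr (M \<Otimes>\<^sub>M unit_noise) (M \<Otimes>\<^sub>M N) (\<lambda>(x, u). (x, r (H x u))) = L"
      by simp
  qed
qed

section \<open>Relatively independent gluing\<close>

lemma section_density_equivariant:
  assumes "sigma_finite_measure M" and L: "sets L = sets (M \<Otimes>\<^sub>M N)"
    and P: "P \<in> borel_measurable M" "\<And>A. A \<in> sets M \<Longrightarrow> (\<integral>\<^sup>+x\<in>A. P x \<partial>M) = emeasure L (A \<times> E)"
    and P': "P' \<in> borel_measurable M"
      "\<And>A. A \<in> sets M \<Longrightarrow> (\<integral>\<^sup>+x\<in>A. P' x \<partial>M) = emeasure L (A \<times> (S -` E \<inter> space N))"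
    and E: "E \<in> sets N"
    and T: "T \<in> M \<rightarrow>\<^sub>M M" "T' \<in> M \<rightarrow>\<^sub>M M" "\<And>x. x \<in> space M \<Longrightarrow> T' (T x) = x" "distr M M T = M"
    and S: "S \<in> N \<rightarrow>\<^sub>M N" and LTS: "distr L L (\<lambda>(x, y). (T x, S y)) = L"
  shows "AE x in M. P (T x) = P' x"
proof -
  interpret sigma_finite_measure M by fact
  note [measurable] = P(1) P'(1) T(1,2) S
  show ?thesis
  proof (rule density_unique2)
    show "(\<lambda>x. P (T x)) \<in> borel_measurable M" "P' \<in> borel_measurable M"
      by measurable
    fix A assume A [measurable]: "A \<in> sets M"
    \<comment> \<open>Chosen so that \<open>T x\<close> lies in it exactly when \<open>x\<close>
      lies in \<open>A\<close>, because \<open>T'\<close> undoes \<open>T\<close>.\<close>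
    let ?C = "T' -` A \<inter> space M"
    have C: "?C \<in> sets M"
      by measurable
    have "(\<integral>\<^sup>+x\<in>A. P (T x) \<partial>M) = (\<integral>\<^sup>+x. P (T x) * indicator ?C (T x) \<partial>M)"
      using T(3) measurable_space[OF T(1)] by (intro nn_integral_cong) (auto simp: indicator_def)
    also have "\<dots> = (\<integral>\<^sup>+x\<in>?C. P x \<partial>distr M M T)"
      by (subst nn_integral_distr) auto
    also have "\<dots> = emeasure L (?C \<times> E)"
      unfolding T(4) by (rule P(2)[OF C])
    also have "\<dots> = emeasure (distr L L (\<lambda>(x, y). (T x, S y))) (?C \<times> E)"
      by (simp only: LTS)
    also have "\<dots> = emeasure L ((\<lambda>(x, y). (T x, S y)) -` (?C \<times> E) \<inter> space L)"
    proof (rule emeasure_distr)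
      show "(\<lambda>(x, y). (T x, S y)) \<in> L \<rightarrow>\<^sub>M L"
        unfolding measurable_cong_sets[OF L L] by measurable
      show "?C \<times> E \<in> sets L"
        using C E by (simp add: L)
    qed
    also have "(\<lambda>(x, y). (T x, S y)) -` (?C \<times> E) \<inter> space L = A \<times> (S -` E \<inter> space N)"
      using sets_eq_imp_space_eq[OF L] T(3) measurable_space[OF T(1)] sets.sets_into_space[OF A]
      by (auto simp: space_pair_measure)
    also have "emeasure L \<dots> = (\<integral>\<^sup>+x\<in>A. P' x \<partial>M)"
      by (rule P'(2)[OF A, symmetric])
    finally show "(\<integral>\<^sup>+x\<in>A. P (T x) \<partial>M) = (\<integral>\<^sup>+x\<in>A. P' x \<partial>M)" .
  qed
qed

text \<open>Each \<open>n\<close> gets its own noise coordinate, which makes the second coordinates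
  conditionally independent given the first. Invariance is claimed only for the law of the second
  coordinates; the metric and the class argument both use it in this form.\<close>

lemma relatively_independent_gluing:
  fixes L :: "nat \<Rightarrow> ('a \<times> 'b) measure" and N :: "'b measure"
  assumes "prob_space M" and prob_L: "\<And>n. prob_space (L n)"
    and L: "\<And>n. sets (L n) = sets (M \<Otimes>\<^sub>M N)" "\<And>n. distr (L n) M fst = M"
    and e: "e \<in> borel_measurable N" and r: "r \<in> borel \<rightarrow>\<^sub>M N"
    and re: "\<And>y. y \<in> space N \<Longrightarrow> r (e y) = y" and e01: "\<And>y. y \<in> space N \<Longrightarrow> e y \<in> {0<..<1::real}"
  obtains K where "prob_space K" "sets K = sets (M \<Otimes>\<^sub>M PiM UNIV (\<lambda>_. N))"
    "\<And>n. distr K (M \<Otimes>\<^sub>M N) (\<lambda>(x, y). (x, y n)) = L n"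
    "\<And>T T' S. \<lbrakk>T \<in> M \<rightarrow>\<^sub>M M; T' \<in> M \<rightarrow>\<^sub>M M; \<And>x. x \<in> space M \<Longrightarrow> T' (T x) = x; distr M M T = M;
        S \<in> N \<rightarrow>\<^sub>M N; \<And>n. distr (L n) (L n) (\<lambda>(x, y). (T x, S y)) = L n\<rbrakk> \<Longrightarrow>
        distr (distr K (PiM UNIV (\<lambda>_. N)) snd) (PiM UNIV (\<lambda>_. N)) (\<lambda>y n. S (y n)) = distr K (PiM UNIV (\<lambda>_. N)) snd"
proof -
  interpret M: prob_space M by fact
  interpret U: prob_space unit_noise by (rule prob_space_unit_noise)
  define W where "W = PiM UNIV (\<lambda>_::nat. unit_noise)"
  interpret W: product_prob_space "\<lambda>_::nat. unit_noise" UNIV ..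
  interpret PW: prob_space W
    unfolding W_def by (rule W.prob_space_axioms)
  interpret MW: pair_prob_space M W ..
  let ?P = "PiM UNIV (\<lambda>_::nat. N)"
  have "\<exists>H. (\<lambda>(x, u). H x u) \<in> M \<Otimes>\<^sub>M unit_noise \<rightarrow>\<^sub>M N \<and>
      distr (M \<Otimes>\<^sub>M unit_noise) (M \<Otimes>\<^sub>M N) (\<lambda>(x, u). (x, H x u)) = L n" for n
    by (rule noise_outsourcing[OF assms(1) prob_L L e r re e01]) auto
  then obtain H where H: "\<And>n. (\<lambda>(x, u). H n x u) \<in> M \<Otimes>\<^sub>M unit_noise \<rightarrow>\<^sub>M N"
      and H_distr: "\<And>n. distr (M \<Otimes>\<^sub>M unit_noise) (M \<Otimes>\<^sub>M N) (\<lambda>(x, u). (x, H n x u)) = L n"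
    by metis
  have [measurable]: "(\<lambda>p. H n (fst p) (snd p)) \<in> M \<Otimes>\<^sub>M unit_noise \<rightarrow>\<^sub>M N" for n
    using H[of n] by (simp add: case_prod_beta)
  have coord [measurable]: "(\<lambda>w. w n) \<in> W \<rightarrow>\<^sub>M unit_noise" for n
    unfolding W_def by measurable
  have H_W [measurable]: "(\<lambda>p. H n (fst p) (snd p n)) \<in> M \<Otimes>\<^sub>M W \<rightarrow>\<^sub>M N" for n
  proof -
    have "(\<lambda>p. (fst p, snd p n)) \<in> M \<Otimes>\<^sub>M W \<rightarrow>\<^sub>M M \<Otimes>\<^sub>M unit_noise"
      by measurable
    from measurable_compose[OF this, of "\<lambda>p. H n (fst p) (snd p)" N] show ?thesis
      by simp
  qed
  have H_P [measurable]: "(\<lambda>p n. H n (fst p) (snd p n)) \<in> M \<Otimes>\<^sub>M W \<rightarrow>\<^sub>M ?P"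
    by (rule measurable_PiM_single') (auto intro: measurable_space[OF H_W])
  define K where "K = distr (M \<Otimes>\<^sub>M W) (M \<Otimes>\<^sub>M ?P) (\<lambda>p. (fst p, \<lambda>n. H n (fst p) (snd p n)))"
  have K_meas [measurable]: "(\<lambda>p. (fst p, \<lambda>n. H n (fst p) (snd p n))) \<in> M \<Otimes>\<^sub>M W \<rightarrow>\<^sub>M M \<Otimes>\<^sub>M ?P"
    by (intro measurable_Pair measurable_fst H_P)
  define \<kappa> where "\<kappa> = distr K ?P snd"
  have \<kappa>_eq: "\<kappa> = distr (M \<Otimes>\<^sub>M W) ?P (\<lambda>p n. H n (fst p) (snd p n))"
    unfolding \<kappa>_def K_def by (subst distr_distr) (auto simp: comp_def)
  have prob_K: "prob_space K"
    unfolding K_def by (intro MW.prob_space_distr) measurable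
  have prob_\<kappa>: "prob_space \<kappa>"
    unfolding \<kappa>_eq by (intro MW.prob_space_distr) measurable
  \<comment> \<open>The conditional probability of \<open>E\<close> given \<open>x\<close> under
    \<open>L n\<close>, read off from the noise. \<open>P_int\<close> below identifies it as a
    density of the kind handled by \<open>section_density_equivariant\<close>.\<close>
  define P where "P n E x = emeasure unit_noise {u. H n x u \<in> E}" for n E x
  have P_alt: "P n E x = emeasure unit_noise (Pair x -` ((\<lambda>p. H n (fst p) (snd p)) -` E \<inter> space (M \<Otimes>\<^sub>M unit_noise)))"
    if "x \<in> space M" for n E x
    using that by (auto simp: P_def space_pair_measure vimage_def intro!: arg_cong[where f="emeasure unit_noise"])
  have P_meas: "P n E \<in> borel_measurable M" if [measurable]: "E \<in> sets N" for n E
  proof -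
    have "(\<lambda>p. H n (fst p) (snd p)) -` E \<inter> space (M \<Otimes>\<^sub>M unit_noise) \<in> sets (M \<Otimes>\<^sub>M unit_noise)"
      by measurable
    from U.measurable_emeasure_Pair[OF this] show ?thesis
      by (subst measurable_cong[OF P_alt]) auto
  qed
  have P_int: "(\<integral>\<^sup>+x\<in>A. P n E x \<partial>M) = emeasure (L n) (A \<times> E)"
    if A [measurable]: "A \<in> sets M" and E [measurable]: "E \<in> sets N" for n A E
  proof -
    let ?S = "{p \<in> space (M \<Otimes>\<^sub>M unit_noise). fst p \<in> A \<and> H n (fst p) (snd p) \<in> E}"
    have "emeasure (L n) (A \<times> E) = emeasure (M \<Otimes>\<^sub>M unit_noise) ((\<lambda>p. (fst p, H n (fst p) (snd p))) -` (A \<times> E) \<inter> space (M \<Otimes>\<^sub>M unit_noise))"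
      unfolding H_distr[symmetric] case_prod_beta by (rule emeasure_distr) measurable
    also have "(\<lambda>p. (fst p, H n (fst p) (snd p))) -` (A \<times> E) \<inter> space (M \<Otimes>\<^sub>M unit_noise) = ?S"
      by auto
    also have "emeasure (M \<Otimes>\<^sub>M unit_noise) ?S = (\<integral>\<^sup>+x. emeasure unit_noise (Pair x -` ?S) \<partial>M)"
      by (rule U.emeasure_pair_measure_alt) measurable
    also have "\<dots> = (\<integral>\<^sup>+x\<in>A. P n E x \<partial>M)"
      by (intro nn_integral_cong) (auto simp: space_pair_measure indicator_def vimage_def P_def)
    finally show ?thesis ..
  qed
  have cyl_sets [measurable]: "prod_emb UNIV (\<lambda>_. N) J (Pi\<^sub>E J E) \<in> sets ?P"
    if "finite J" "\<And>j. j \<in> J \<Longrightarrow> E j \<in> sets N" for J and E :: "nat \<Rightarrow> 'b set"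
    using that by (intro sets_PiM_I) auto
  \<comment> \<open>Fubini over \<open>M\<close>; in each fibre, independence of the noise
    coordinates turns the cylinder into a product.\<close>
  have cyl: "emeasure \<kappa> (prod_emb UNIV (\<lambda>_. N) J (Pi\<^sub>E J E)) = (\<integral>\<^sup>+x. (\<Prod>j\<in>J. P j (E j) x) \<partial>M)"
    if J: "finite J" and E: "\<And>j. j \<in> J \<Longrightarrow> E j \<in> sets N" for J E
  proof -
    let ?S = "{p \<in> space (M \<Otimes>\<^sub>M W). \<forall>j\<in>J. H j (fst p) (snd p j) \<in> E j}"
    have "emeasure \<kappa> (prod_emb UNIV (\<lambda>_. N) J (Pi\<^sub>E J E)) =
        emeasure (M \<Otimes>\<^sub>M W) ((\<lambda>p n. H n (fst p) (snd p n)) -` prod_emb UNIV (\<lambda>_. N) J (Pi\<^sub>E J E) \<inter> space (M \<Otimes>\<^sub>M W))"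
      unfolding \<kappa>_eq using J E by (intro emeasure_distr) measurable
    also have "(\<lambda>p n. H n (fst p) (snd p n)) -` prod_emb UNIV (\<lambda>_. N) J (Pi\<^sub>E J E) \<inter> space (M \<Otimes>\<^sub>M W) = ?S"
      using measurable_space[OF H_W] by (auto simp: prod_emb_def Pi_iff)
    also have "emeasure (M \<Otimes>\<^sub>M W) ?S = (\<integral>\<^sup>+x. emeasure W (Pair x -` ?S) \<partial>M)"
    proof (rule PW.emeasure_pair_measure_alt)
      have "Measurable.pred (M \<Otimes>\<^sub>M W) (\<lambda>p. H j (fst p) (snd p j) \<in> E j)" if "j \<in> J" for j
        using E[OF that] by measurable
      then show "?S \<in> sets (M \<Otimes>\<^sub>M W)"
        using J by (intro predE pred_intros_finite) auto
    qed
    also have "\<dots> = (\<integral>\<^sup>+x. (\<Prod>j\<in>J. P j (E j) x) \<partial>M)"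
    proof (rule nn_integral_cong)
      fix x assume x: "x \<in> space M"
      have "{u. H j x u \<in> E j} \<in> sets unit_noise" if "j \<in> J" for j
      proof -
        have "H j x \<in> unit_noise \<rightarrow>\<^sub>M N"
          using measurable_Pair2[OF H[of j] x] by simp
        from measurable_sets[OF this E[OF that]] show ?thesis
          by (simp add: vimage_def)
      qed
      then have "emeasure W {w \<in> space W. \<forall>j\<in>J. w j \<in> {u. H j x u \<in> E j}} = (\<Prod>j\<in>J. P j (E j) x)"
        unfolding W_def P_def using J by (intro W.emeasure_PiM_Collect) auto
      moreover have "Pair x -` ?S = {w \<in> space W. \<forall>j\<in>J. w j \<in> {u. H j x u \<in> E j}}"
        using x by (auto simp: space_pair_measure)
      ultimately show "emeasure W (Pair x -` ?S) = (\<Prod>j\<in>J. P j (E j) x)"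
        by simp
    qed
    finally show ?thesis .
  qed
  show thesis
  proof
    show "prob_space K" by fact
    show "sets K = sets (M \<Otimes>\<^sub>M ?P)"
      by (simp add: K_def)
    show "distr K (M \<Otimes>\<^sub>M N) (\<lambda>(x, y). (x, y n)) = L n" for n
    proof -
      have "distr W unit_noise (\<lambda>w. w n) = unit_noise"
        unfolding W_def by (rule distr_PiM_component) (auto simp: prob_space_unit_noise)
      then have "M \<Otimes>\<^sub>M unit_noise = distr M M (\<lambda>x. x) \<Otimes>\<^sub>M distr W unit_noise (\<lambda>w. w n)"
        by simp
      also have "\<dots> = distr (M \<Otimes>\<^sub>M W) (M \<Otimes>\<^sub>M unit_noise) (\<lambda>(x, w). (x, w n))"
        by (intro pair_measure_distr prob_space_imp_sigma_finite PW.prob_space_distr) measurable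
      finally have *: "distr (M \<Otimes>\<^sub>M W) (M \<Otimes>\<^sub>M unit_noise) (\<lambda>p. (fst p, snd p n)) = M \<Otimes>\<^sub>M unit_noise"
        by (simp add: case_prod_beta')
      have "distr K (M \<Otimes>\<^sub>M N) (\<lambda>(x, y). (x, y n)) = distr (M \<Otimes>\<^sub>M W) (M \<Otimes>\<^sub>M N) (\<lambda>p. (fst p, H n (fst p) (snd p n)))"
        unfolding K_def by (subst distr_distr) (auto simp: comp_def)
      also have "\<dots> = distr (distr (M \<Otimes>\<^sub>M W) (M \<Otimes>\<^sub>M unit_noise) (\<lambda>p. (fst p, snd p n))) (M \<Otimes>\<^sub>M N) (\<lambda>p. (fst p, H n (fst p) (snd p)))"
        by (subst distr_distr) (auto simp: comp_def)
      also have "\<dots> = L n"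
        unfolding * H_distr[symmetric] by (simp add: case_prod_beta')
      finally show ?thesis .
    qed
    fix T T' S
    assume T [measurable]: "T \<in> M \<rightarrow>\<^sub>M M" and T' [measurable]: "T' \<in> M \<rightarrow>\<^sub>M M"
      and T'T: "\<And>x. x \<in> space M \<Longrightarrow> T' (T x) = x" and MT: "distr M M T = M"
      and S [measurable]: "S \<in> N \<rightarrow>\<^sub>M N" and LTS: "\<And>n. distr (L n) (L n) (\<lambda>(x, y). (T x, S y)) = L n"
    have S_P [measurable]: "(\<lambda>y n. S (y n)) \<in> ?P \<rightarrow>\<^sub>M ?P"
      by (rule measurable_PiM_single') (auto simp: space_PiM intro: measurable_space[OF S])
    have equiv: "AE x in M. P n E (T x) = P n (S -` E \<inter> space N) x" if E: "E \<in> sets N" for n E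
    proof -
      have SE: "S -` E \<inter> space N \<in> sets N"
        using E by measurable
      show ?thesis
        by (rule section_density_equivariant[OF M.sigma_finite_measure_axioms L(1) P_meas[OF E] P_int[OF _ E]
              P_meas[OF SE] P_int[OF _ SE] E T T' T'T MT S LTS])
    qed
    show "distr (distr K ?P snd) ?P (\<lambda>y n. S (y n)) = distr K ?P snd"
      unfolding \<kappa>_def[symmetric]
    proof (rule measure_eqI_PiM_infinite)
      show "finite_measure (distr \<kappa> ?P (\<lambda>y n. S (y n)))"
        using prob_\<kappa> by (intro finite_measure.finite_measure_distr prob_space.axioms) (auto simp: \<kappa>_def)
      fix E J assume J: "finite J" "J \<subseteq> (UNIV :: nat set)" and E: "\<And>i. i \<in> J \<Longrightarrow> E i \<in> sets N"
      have SE: "S -` E j \<inter> space N \<in> sets N" if "j \<in> J" for j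
        using E[OF that] by measurable
      have "emeasure (distr \<kappa> ?P (\<lambda>y n. S (y n))) (prod_emb UNIV (\<lambda>_. N) J (Pi\<^sub>E J E))
          = emeasure \<kappa> ((\<lambda>y n. S (y n)) -` prod_emb UNIV (\<lambda>_. N) J (Pi\<^sub>E J E) \<inter> space \<kappa>)"
        using J E by (intro emeasure_distr) (auto simp: \<kappa>_def)
      also have "(\<lambda>y n. S (y n)) -` prod_emb UNIV (\<lambda>_. N) J (Pi\<^sub>E J E) \<inter> space \<kappa>
          = prod_emb UNIV (\<lambda>_. N) J (Pi\<^sub>E J (\<lambda>j. S -` E j \<inter> space N))"
        using measurable_space[OF S] by (auto simp: prod_emb_def \<kappa>_def space_PiM Pi_iff PiE_iff)
      also have "emeasure \<kappa> \<dots> = (\<integral>\<^sup>+x. (\<Prod>j\<in>J. P j (S -` E j \<inter> space N) x) \<partial>M)"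
        by (rule cyl[OF J(1) SE])
      \<comment> \<open>A cylinder involves finitely many sets, so the exceptional null sets can be
        united. Invariance of \<open>M\<close> then removes \<open>T\<close>.\<close>
      also have "\<dots> = (\<integral>\<^sup>+x. (\<Prod>j\<in>J. P j (E j) (T x)) \<partial>M)"
      proof (rule nn_integral_cong_AE)
        have "AE x in M. \<forall>j\<in>J. P j (E j) (T x) = P j (S -` E j \<inter> space N) x"
          using J E equiv by (intro AE_finite_allI) auto
        then show "AE x in M. (\<Prod>j\<in>J. P j (S -` E j \<inter> space N) x) = (\<Prod>j\<in>J. P j (E j) (T x))"
          by eventually_elim (auto intro: prod.cong)
      qed
      also have "\<dots> = (\<integral>\<^sup>+x. (\<Prod>j\<in>J. P j (E j) x) \<partial>distr M M T)"
        using P_meas[OF E] by (subst nn_integral_distr) (auto intro!: borel_measurable_prod_ennreal)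
      also have "\<dots> = emeasure \<kappa> (prod_emb UNIV (\<lambda>_. N) J (Pi\<^sub>E J E))"
        unfolding MT by (rule cyl[OF J(1) E, symmetric])
      finally show "emeasure (distr \<kappa> ?P (\<lambda>y n. S (y n))) (prod_emb UNIV (\<lambda>_. N) J (Pi\<^sub>E J E))
          = emeasure \<kappa> (prod_emb UNIV (\<lambda>_. N) J (Pi\<^sub>E J E))" .
    qed (simp_all add: \<kappa>_def)
  qed
qed

section \<open>The metric on invariant measures\<close>

text \<open>Indicators of closed sets are limits of the Lipschitz functions
  \<open>max 0 (1 - n infdist x C)\<close>, and closed sets are an intersection-stable generator.
  Lipschitz test functions suit the metric: moving mass along a joining changes such an integral by
  at most the Lipschitz constant times the cost.\<close>

lemma lipschitz_measure_eqI:
  fixes X :: "'a::metric_space set"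
  assumes "finite_measure M"
    and M: "sets M = sets (restrict_space borel X)" and N: "sets N = sets (restrict_space borel X)"
    and eq: "\<And>h k. \<lbrakk>0 \<le> k; \<And>x y. \<bar>h x - h y\<bar> \<le> k * dist x y; \<And>x. 0 \<le> h x; \<And>x. h x \<le> (1::real)\<rbrakk> \<Longrightarrow>
      (\<integral>\<^sup>+x. ennreal (h x) \<partial>M) = (\<integral>\<^sup>+x. ennreal (h x) \<partial>N)"
  shows "M = N"
proof -
  have id: "(\<lambda>x. x) \<in> borel_measurable M" "(\<lambda>x. x) \<in> borel_measurable N"
    unfolding measurable_cong_sets[OF M refl] measurable_cong_sets[OF N refl]
    by (rule measurable_restrict_space1, simp)+
  \<comment> \<open>The constant 1 is an admissible test function with Lipschitz constant 0, so
    \<open>N\<close> inherits finiteness from \<open>M\<close>.\<close>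
  have total: "emeasure M (space M) = emeasure N (space N)"
    using eq[of 0 "\<lambda>_. 1"] by simp
  interpret M: finite_measure M by fact
  interpret N: finite_measure N
    by standard (use total M.emeasure_finite in auto)
  \<comment> \<open>The measures are compared on the whole type, where closed sets generate; sets of
    the form \<open>X \<inter> D\<close> are treated at the end.\<close>
  let ?M = "distr M borel (\<lambda>x. x)" and ?N = "distr N borel (\<lambda>x. x)"
  have closed: "emeasure ?M C = emeasure ?N C" if C: "closed C" "C \<noteq> {}" for C
  proof -
    define h where "h n x = max 0 (1 - real n * infdist x C)" for n x
    have h01: "0 \<le> h n x" "h n x \<le> 1" for n x
      by (simp_all add: h_def infdist_nonneg)
    have lip: "\<bar>h n x - h n y\<bar> \<le> real n * dist x y" for n x y
    proof -
      have "\<bar>h n x - h n y\<bar> \<le> \<bar>real n * infdist x C - real n * infdist y C\<bar>"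
        by (auto simp: h_def max_def abs_if)
      also have "\<dots> = real n * \<bar>infdist x C - infdist y C\<bar>"
        by (simp add: abs_mult flip: right_diff_distrib)
      also have "\<dots> \<le> real n * dist x y"
        using infdist_triangle_abs[of x C y] by (intro mult_left_mono) auto
      finally show ?thesis .
    qed
    have lim: "(\<lambda>n. ennreal (h n x)) \<longlonglongrightarrow> indicator C x" for x
    proof (cases "x \<in> C")
      case True
      then show ?thesis by (simp add: h_def)
    next
      case False
      then have "0 < infdist x C"
        using C infdist_pos_not_in_closed by blast
      then obtain m where m: "1 < real m * infdist x C"
        using ex_less_of_nat_mult by blast
      have "h n x = 0" if "m \<le> n" for n
      proof -
        have "real m * infdist x C \<le> real n * infdist x C"
          using that infdist_nonneg by (intro mult_right_mono) auto
        then show ?thesis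
          using m by (simp add: h_def)
      qed
      then have "eventually (\<lambda>n. ennreal (h n x) = 0) sequentially"
        unfolding eventually_sequentially by (intro exI[of _ m]) simp
      then show ?thesis
        using False by (simp add: tendsto_eventually)
    qed
    have h_meas [measurable]: "h n \<in> borel_measurable borel" for n
      unfolding h_def by (intro borel_measurable_continuous_onI continuous_intros)
    have conv: "(\<lambda>n. \<integral>\<^sup>+x. ennreal (h n x) \<partial>K) \<longlonglongrightarrow> emeasure (distr K borel (\<lambda>x. x)) C"
      if "finite_measure K" "(\<lambda>x. x) \<in> borel_measurable K" for K
    proof -
      interpret finite_measure K by fact
      note [measurable] = that(2)
      have [measurable]: "C \<in> sets borel"
        using C by simp
      have "(\<lambda>n. \<integral>\<^sup>+x. ennreal (h n x) \<partial>K) \<longlonglongrightarrow> (\<integral>\<^sup>+x. indicator C x \<partial>K)"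
      proof (rule nn_integral_dominated_convergence[where w="\<lambda>_. 1"])
        show "(\<lambda>x. ennreal (h n x)) \<in> borel_measurable K" for n
          using measurable_compose[OF that(2) h_meas[of n]] by simp
        show "(\<lambda>x. indicator C x :: ennreal) \<in> borel_measurable K"
          by measurable
        show "AE x in K. ennreal (h n x) \<le> 1" for n
          using h01 by (intro AE_I2) (simp add: ennreal_le_1)
        show "(\<integral>\<^sup>+x. 1 \<partial>K) < \<infinity>"
          by (simp add: emeasure_finite less_top[symmetric])
        show "AE x in K. (\<lambda>n. ennreal (h n x)) \<longlonglongrightarrow> indicator C x"
          using lim by simp
      qed simp
      also have "(\<integral>\<^sup>+x. indicator C x \<partial>K) = emeasure (distr K borel (\<lambda>x. x)) C"
        by (subst nn_integral_distr[of "\<lambda>x. x" K borel "indicator C", symmetric]) auto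
      finally show ?thesis .
    qed
    have "(\<integral>\<^sup>+x. ennreal (h n x) \<partial>M) = (\<integral>\<^sup>+x. ennreal (h n x) \<partial>N)" for n
      using lip h01 by (intro eq[of "real n"]) auto
    then show ?thesis
      using conv[OF M.finite_measure_axioms id(1)] conv[OF N.finite_measure_axioms id(2)] LIMSEQ_unique by auto
  qed
  have "?M = ?N"
  proof (rule measure_eqI_generator_eq[where E="Collect closed" and \<Omega>=UNIV and A="\<lambda>_. UNIV"])
    show "Int_stable (Collect closed)"
      by (auto simp: Int_stable_def)
    show "emeasure ?M C = emeasure ?N C" if "C \<in> Collect closed" for C
      using closed that by (cases "C = {}") auto
    show "sets ?M = sigma_sets UNIV (Collect closed)" "sets ?N = sigma_sets UNIV (Collect closed)"
      by (simp_all add: borel_eq_closed)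
    show "emeasure ?M UNIV \<noteq> \<infinity>" for i :: nat
      using id by (simp add: emeasure_distr M.emeasure_finite)
  qed auto
  show ?thesis
  proof (rule measure_eqI)
    show "sets M = sets N"
      by (simp add: M N)
    fix A assume "A \<in> sets M"
    then obtain D where D: "D \<in> sets borel" "A = X \<inter> D"
      unfolding M sets_restrict_space by blast
    have sp: "space M = X" "space N = X"
      using sets_eq_imp_space_eq[OF M] sets_eq_imp_space_eq[OF N] by (simp_all add: space_restrict_space)
    have "emeasure M A = emeasure ?M D" "emeasure N A = emeasure ?N D"
      using D id by (simp_all add: emeasure_distr sp Int_commute)
    with \<open>?M = ?N\<close> show "emeasure M A = emeasure N A"
      by simp
  qed
qed

lemma distr_pair_snd:
  assumes "prob_space M" "prob_space N"
  shows "distr (M \<Otimes>\<^sub>M N) N snd = N"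
proof -
  interpret M: prob_space M by fact
  interpret N: prob_space N by fact
  interpret P: pair_sigma_finite N M ..
  have "distr (M \<Otimes>\<^sub>M N) N snd = distr (distr (N \<Otimes>\<^sub>M M) (M \<Otimes>\<^sub>M N) (\<lambda>(x, y). (y, x))) N snd"
    using P.distr_pair_swap pair_sigma_finite.distr_pair_swap[of M N] M.sigma_finite_measure_axioms N.sigma_finite_measure_axioms
    by (metis pair_sigma_finite.intro)
  also have "\<dots> = distr (N \<Otimes>\<^sub>M M) N fst"
    by (subst distr_distr) (auto simp: comp_def case_prod_beta')
  also have "\<dots> = N"
    by (rule M.distr_pair_fst)
  finally show ?thesis .
qed

lemma AE_eq_of_nn_integral_le:
  assumes [measurable]: "f \<in> borel_measurable M" "g \<in> borel_measurable M"
    and le: "AE x in M. f x \<le> g x" and int: "integral\<^sup>N M g \<le> integral\<^sup>N M f" "integral\<^sup>N M f < \<infinity>"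
  shows "AE x in M. f x = g x"
proof -
  have "(\<integral>\<^sup>+x. g x - f x \<partial>M) = integral\<^sup>N M g - integral\<^sup>N M f"
    using le int by (intro nn_integral_diff) auto
  also have "\<dots> = 0"
    using int by (auto intro: diff_eq_0_ennreal)
  finally have "AE x in M. g x - f x = 0"
    by (subst (asm) nn_integral_0_iff_AE) auto
  moreover have "AE x in M. f x \<noteq> \<infinity>"
    using int by (intro nn_integral_PInf_AE) auto
  ultimately show ?thesis
    using le
  proof eventually_elim
    case (elim x)
    then have "g x \<le> f x"
      by (simp add: diff_eq_0_iff_ennreal)
    with elim show ?case by (simp add: order_antisym)
  qed
qed

section \<open>Invariant measures, their joinings and the cost of a joining\<close>

locale compact_action =
  fixes G :: "('g, 'b) monoid_scheme" and X :: "'x::metric_space set" and \<phi> :: "'g \<Rightarrow> 'x \<Rightarrow> 'x"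
  assumes group: "group G" and countable_carrier: "countable (carrier G)" and compact: "compact X"
    and action: "group_action G X \<phi>"
    and homeo: "\<And>g. g \<in> carrier G \<Longrightarrow> homeomorphism X X (\<phi> g) (\<phi> (inv\<^bsub>G\<^esub> g))"
begin

abbreviation "B \<equiv> restrict_space borel X"

abbreviation "\<M> \<equiv> invariant_measures G X \<phi>"

abbreviation "cost L \<equiv> \<integral>p. dist (fst p) (snd p) \<partial>L"

lemma inv_carrier [simp]: "g \<in> carrier G \<Longrightarrow> inv\<^bsub>G\<^esub> g \<in> carrier G"
  using group by simp

lemma space_B: "space B = X"
  by (simp add: space_restrict_space)

lemma act_X: "g \<in> carrier G \<Longrightarrow> x \<in> X \<Longrightarrow> \<phi> g x \<in> X"
  using homeomorphism_image1[OF homeo, of g] by blast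

lemma act_inv: "g \<in> carrier G \<Longrightarrow> x \<in> X \<Longrightarrow> \<phi> (inv\<^bsub>G\<^esub> g) (\<phi> g x) = x"
  by (rule homeomorphism_apply1[OF homeo])

lemma act_measurable: "g \<in> carrier G \<Longrightarrow> \<phi> g \<in> B \<rightarrow>\<^sub>M B"
  using homeomorphism_cont1[OF homeo, of g] act_X
  by (intro measurable_restrict_space2 borel_measurable_continuous_on_restrict) (auto simp: space_restrict_space)

lemma invariant_measuresD:
  assumes "M \<in> \<M>"
  shows "prob_space M" "sets M = sets B" "space M = X"
    "\<And>g. g \<in> carrier G \<Longrightarrow> distr M M (\<phi> g) = M" "\<And>g. g \<in> carrier G \<Longrightarrow> \<phi> g \<in> M \<rightarrow>\<^sub>M M"
proof -
  show sets: "sets M = sets B"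
    using assms by (simp add: invariant_measures_def)
  show "prob_space M" "\<And>g. g \<in> carrier G \<Longrightarrow> distr M M (\<phi> g) = M"
    using assms by (auto simp: invariant_measures_def)
  show "space M = X"
    using sets_eq_imp_space_eq[OF sets] by (simp add: space_B)
  show "\<phi> g \<in> M \<rightarrow>\<^sub>M M" if "g \<in> carrier G" for g
    using act_measurable[OF that] by (simp add: measurable_cong_sets[OF sets sets])
qed

lemma nonempty: "M \<in> \<M> \<Longrightarrow> X \<noteq> {}"
  using invariant_measuresD(1,3) prob_space.not_empty by blast

lemma dist_meas_B [measurable]: "(\<lambda>p. dist (fst p) (snd p)) \<in> borel_measurable (B \<Otimes>\<^sub>M B)"
  by (rule measurable_dist_compact[OF compact])

lemma dist_bounded: obtains D where "0 \<le> D" "\<And>x y. x \<in> X \<Longrightarrow> y \<in> X \<Longrightarrow> dist x y \<le> D"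
proof
  show "0 \<le> diameter X"
    by (rule diameter_ge_0[OF compact_imp_bounded[OF compact]])
  show "dist x y \<le> diameter X" if "x \<in> X" "y \<in> X" for x y
    using diameter_bounded_bound[OF compact_imp_bounded[OF compact] that] .
qed

lemma integrable_dist:
  assumes "prob_space L" "sets L = sets (B \<Otimes>\<^sub>M B)"
  shows "integrable L (\<lambda>p. dist (fst p) (snd p))"
    and "(\<integral>\<^sup>+p. ennreal (dist (fst p) (snd p)) \<partial>L) = ennreal (cost L)"
proof -
  interpret prob_space L by fact
  obtain D where D: "0 \<le> D" "\<And>x y. x \<in> X \<Longrightarrow> y \<in> X \<Longrightarrow> dist x y \<le> D"
    using dist_bounded by blast
  have sp: "space L = X \<times> X"
    using sets_eq_imp_space_eq[OF assms(2)] by (simp add: space_pair_measure space_B)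
  show *: "integrable L (\<lambda>p. dist (fst p) (snd p))"
    using dist_meas_B D
    by (intro integrable_const_bound[of _ D] AE_I2) (auto simp: sp measurable_cong_sets[OF assms(2) refl])
  show "(\<integral>\<^sup>+p. ennreal (dist (fst p) (snd p)) \<partial>L) = ennreal (cost L)"
    by (rule nn_integral_eq_integral[OF *]) auto
qed

lemma joiningsD:
  assumes "M \<in> \<M>" "N \<in> \<M>" "L \<in> joinings G \<phi> M N"
  shows "prob_space L" "sets L = sets (B \<Otimes>\<^sub>M B)" "space L = X \<times> X"
    "\<And>g. g \<in> carrier G \<Longrightarrow> distr L L (\<lambda>(x, z). (\<phi> g x, \<phi> g z)) = L"
    "distr L M fst = M" "distr L N snd = N" "fst \<in> L \<rightarrow>\<^sub>M M" "snd \<in> L \<rightarrow>\<^sub>M N"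
proof -
  show 1: "sets L = sets (B \<Otimes>\<^sub>M B)"
    using assms invariant_measuresD(2)[OF assms(1)] invariant_measuresD(2)[OF assms(2)]
    by (simp add: joinings_def cong: sets_pair_measure_cong)
  show "prob_space L" "\<And>g. g \<in> carrier G \<Longrightarrow> distr L L (\<lambda>(x, z). (\<phi> g x, \<phi> g z)) = L"
    "distr L M fst = M" "distr L N snd = N"
    using assms(3) by (auto simp: joinings_def)
  show "space L = X \<times> X"
    using sets_eq_imp_space_eq[OF 1] by (simp add: space_pair_measure space_B)
  show "fst \<in> L \<rightarrow>\<^sub>M M" "snd \<in> L \<rightarrow>\<^sub>M N"
    using invariant_measuresD(2)[OF assms(1)] invariant_measuresD(2)[OF assms(2)]
    by (simp_all cong: measurable_cong_sets add: 1)
qed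

lemma joiningsI:
  assumes "M \<in> \<M>" "N \<in> \<M>" "prob_space L" "sets L = sets (B \<Otimes>\<^sub>M B)"
    "\<And>g. g \<in> carrier G \<Longrightarrow> distr L (B \<Otimes>\<^sub>M B) (\<lambda>(x, z). (\<phi> g x, \<phi> g z)) = L"
    "distr L B fst = M" "distr L B snd = N"
  shows "L \<in> joinings G \<phi> M N"
proof -
  note s = invariant_measuresD(2)[OF assms(1)] invariant_measuresD(2)[OF assms(2)]
  have "sets L = sets (M \<Otimes>\<^sub>M N)"
    using s assms(4) by (simp cong: sets_pair_measure_cong)
  moreover have "distr L L (\<lambda>(x, z). (\<phi> g x, \<phi> g z)) = L" if "g \<in> carrier G" for g
    using assms(5)[OF that] distr_cong[OF refl assms(4), of L "\<lambda>(x, z). (\<phi> g x, \<phi> g z)" "\<lambda>(x, z). (\<phi> g x, \<phi> g z)"] by simp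
  moreover have "distr L M fst = M" "distr L N snd = N"
    using assms(6,7) distr_cong[OF refl s(1), of L fst fst] distr_cong[OF refl s(2), of L snd snd] by simp_all
  ultimately show ?thesis
    using assms(3) by (simp add: joinings_def)
qed

text \<open>Ensures that the infimum defining \<open>rho_bar\<close> ranges over a nonempty
  set.\<close>

lemma product_joining:
  assumes "M \<in> \<M>" "N \<in> \<M>"
  shows "M \<Otimes>\<^sub>M N \<in> joinings G \<phi> M N"
proof -
  note M = invariant_measuresD[OF assms(1)] and N = invariant_measuresD[OF assms(2)]
  interpret M: prob_space M by (rule M)
  interpret N: prob_space N by (rule N)
  interpret MN: pair_prob_space M N ..
  have "distr (M \<Otimes>\<^sub>M N) (M \<Otimes>\<^sub>M N) (\<lambda>(x, z). (\<phi> g x, \<phi> g z)) = M \<Otimes>\<^sub>M N" if g: "g \<in> carrier G" for g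
    using pair_measure_distr[OF M(5)[OF g] N(5)[OF g]] N.sigma_finite_measure_axioms
    by (simp add: M(4)[OF g] N(4)[OF g])
  then show ?thesis
    using MN.prob_space_axioms N.distr_pair_fst[of M] distr_pair_snd[OF M(1) N(1)]
    by (simp add: joinings_def)
qed

text \<open>Besides symmetry of the metric, this serves to move into the first coordinate the
  measure over which one conditions or glues.\<close>

lemma swap_joining:
  assumes "M \<in> \<M>" "N \<in> \<M>" "L \<in> joinings G \<phi> M N"
  defines "L' \<equiv> distr L (B \<Otimes>\<^sub>M B) (\<lambda>p. (snd p, fst p))"
  shows "L' \<in> joinings G \<phi> N M" "cost L' = cost L"
proof -
  note L = joiningsD[OF assms(1-3)]
  note s = invariant_measuresD(2)[OF assms(1)] invariant_measuresD(2)[OF assms(2)]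
  note [measurable_cong] = L(2)
  interpret prob_space L by (rule L)
  have m [measurable]: "(\<lambda>p. (snd p, fst p)) \<in> L \<rightarrow>\<^sub>M B \<Otimes>\<^sub>M B"
    by measurable
  show "L' \<in> joinings G \<phi> N M"
  proof (rule joiningsI[OF assms(2,1)])
    show "prob_space L'"
      unfolding L'_def by (rule prob_space_distr[OF m])
    show "sets L' = sets (B \<Otimes>\<^sub>M B)"
      by (simp add: L'_def)
    show "distr L' (B \<Otimes>\<^sub>M B) (\<lambda>(x, z). (\<phi> g x, \<phi> g z)) = L'" if g: "g \<in> carrier G" for g
    proof -
      note [measurable] = act_measurable[OF g]
      have g2: "(\<lambda>(x, z). (\<phi> g x, \<phi> g z)) \<in> L \<rightarrow>\<^sub>M L"
        unfolding measurable_cong_sets[OF L(2) L(2)] by measurable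
      have "distr L' (B \<Otimes>\<^sub>M B) (\<lambda>(x, z). (\<phi> g x, \<phi> g z)) = distr L (B \<Otimes>\<^sub>M B) (\<lambda>p. (\<phi> g (snd p), \<phi> g (fst p)))"
        unfolding L'_def by (subst distr_distr) (auto simp: comp_def)
      also have "\<dots> = distr (distr L L (\<lambda>(x, z). (\<phi> g x, \<phi> g z))) (B \<Otimes>\<^sub>M B) (\<lambda>p. (snd p, fst p))"
        using g2 by (subst distr_distr) (auto simp: comp_def case_prod_beta')
      finally show ?thesis
        by (simp add: L(4)[OF g] L'_def)
    qed
    have "distr L' B fst = distr L B snd" "distr L' B snd = distr L B fst"
      unfolding L'_def by (subst distr_distr; auto simp: comp_def)+
    moreover have "distr L B snd = N" "distr L B fst = M"
      using L(5,6) distr_cong[OF refl s(1), of L fst fst] distr_cong[OF refl s(2), of L snd snd] by simp_all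
    ultimately show "distr L' B fst = N" "distr L' B snd = M"
      by simp_all
  qed
  show "cost L' = cost L"
    unfolding L'_def by (subst integral_distr) (auto simp: dist_commute)
qed

section \<open>Estimates for \<open>rho_bar\<close> and the metric axioms\<close>

lemma rho_bar_le: "M \<in> \<M> \<Longrightarrow> N \<in> \<M> \<Longrightarrow> L \<in> joinings G \<phi> M N \<Longrightarrow> rho_bar G X \<phi> M N \<le> cost L"
  unfolding rho_bar_def by (auto intro!: cINF_lower bdd_belowI[of _ 0])

lemma rho_bar_less:
  assumes "M \<in> \<M>" "N \<in> \<M>" "rho_bar G X \<phi> M N < r"
  obtains L where "L \<in> joinings G \<phi> M N" "cost L < r"
proof -
  have "(INF L\<in>joinings G \<phi> M N. cost L) < r"
    using assms by (simp add: rho_bar_def)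
  from cInf_lessD[OF _ this] obtain L where "L \<in> joinings G \<phi> M N" "cost L < r"
    using product_joining[OF assms(1,2)] by auto
  then show thesis by (rule that)
qed

lemma rho_bar_nonneg: "0 \<le> rho_bar G X \<phi> M N"
  unfolding rho_bar_def using product_joining by (auto intro!: cINF_greatest)

lemma rho_bar_commute_le:
  assumes "M \<in> \<M>" "N \<in> \<M>"
  shows "rho_bar G X \<phi> N M \<le> rho_bar G X \<phi> M N"
proof (rule field_le_epsilon)
  fix e :: real assume "0 < e"
  then obtain L where L: "L \<in> joinings G \<phi> M N" "cost L < rho_bar G X \<phi> M N + e"
    using rho_bar_less[OF assms, of "rho_bar G X \<phi> M N + e"] by auto
  show "rho_bar G X \<phi> N M \<le> rho_bar G X \<phi> M N + e"
    using rho_bar_le[OF assms(2,1) swap_joining(1)[OF assms L(1)]] swap_joining(2)[OF assms L(1)] L(2) by simp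
qed

text \<open>Both integrals are taken over \<open>L\<close>, where exchanging the argument of
  \<open>h\<close> costs at most \<open>k\<close> times the distance and a weight
  \<open>w \<le> 1\<close> does not enlarge the error. The weight is 1 when measures are compared,
  and the indicator of an invariant set in the ergodicity proof.\<close>

lemma joining_lipschitz:
  assumes "M \<in> \<M>" "N \<in> \<M>" "L \<in> joinings G \<phi> M N"
    and w: "w \<in> borel_measurable B" "\<And>x. w x \<le> 1"
    and h: "0 \<le> k" "\<And>x y. \<bar>h x - h y\<bar> \<le> k * dist x y" "\<And>x. 0 \<le> h x"
  shows "(\<integral>\<^sup>+x. w x * ennreal (h x) \<partial>M) \<le> (\<integral>\<^sup>+p. w (fst p) * ennreal (h (snd p)) \<partial>L) + ennreal (k * cost L)"
    and "(\<integral>\<^sup>+p. w (fst p) * ennreal (h (snd p)) \<partial>L) \<le> (\<integral>\<^sup>+x. w x * ennreal (h x) \<partial>M) + ennreal (k * cost L)"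
    and "h \<in> borel_measurable B"
proof -
  note L = joiningsD[OF assms(1-3)]
  note s = invariant_measuresD(2)[OF assms(1)]
  note [measurable_cong] = L(2)
  have "continuous_on UNIV h"
    using h(1,2) by (intro lipschitz_on_continuous_on[of k] lipschitz_onI) (auto simp: dist_real_def)
  then show hm: "h \<in> borel_measurable B"
    by (intro measurable_restrict_space1 borel_measurable_continuous_onI)
  note [measurable] = w(1) hm
  have M: "(\<integral>\<^sup>+x. w x * ennreal (h x) \<partial>M) = (\<integral>\<^sup>+p. w (fst p) * ennreal (h (fst p)) \<partial>L)"
  proof -
    have "(\<lambda>x. w x * ennreal (h x)) \<in> borel_measurable M"
      unfolding measurable_cong_sets[OF s refl] by measurable
    then show ?thesis
      by (subst L(5)[symmetric], subst nn_integral_distr[OF L(7)]) (auto simp: L(5))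
  qed
  have int: "(\<integral>\<^sup>+p. ennreal (k * dist (fst p) (snd p)) \<partial>L) = ennreal (k * cost L)"
    using h(1) integrable_dist(2)[OF L(1,2)]
    by (simp add: ennreal_mult nn_integral_cmult)
  have le: "w x * ennreal (h y) \<le> w x * ennreal (h z) + ennreal (k * dist y z)" for x y z
  proof -
    have "ennreal (h y) \<le> ennreal (h z) + ennreal (k * dist y z)"
      using h(2)[of y z] h(3)[of z] h(1) by (subst ennreal_plus[symmetric]) (auto intro!: ennreal_leI simp del: ennreal_plus)
    then have "w x * ennreal (h y) \<le> w x * ennreal (h z) + w x * ennreal (k * dist y z)"
      by (metis distrib_left mult_left_mono zero_le)
    also have "w x * ennreal (k * dist y z) \<le> 1 * ennreal (k * dist y z)"
      using w(2) by (intro mult_right_mono) auto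
    finally show ?thesis
      by (simp add: add_left_mono)
  qed
  have le': "w x * ennreal (h y) \<le> w x * ennreal (h z) + ennreal (k * dist z y)" for x y z
    using le[of x y z] by (simp add: dist_commute)
  show "(\<integral>\<^sup>+x. w x * ennreal (h x) \<partial>M) \<le> (\<integral>\<^sup>+p. w (fst p) * ennreal (h (snd p)) \<partial>L) + ennreal (k * cost L)"
    unfolding M int[symmetric]
    by (subst nn_integral_add[symmetric]) (auto intro!: nn_integral_mono le)
  show "(\<integral>\<^sup>+p. w (fst p) * ennreal (h (snd p)) \<partial>L) \<le> (\<integral>\<^sup>+x. w x * ennreal (h x) \<partial>M) + ennreal (k * cost L)"
    unfolding M int[symmetric]
    by (subst nn_integral_add[symmetric]) (auto intro!: nn_integral_mono le')
qed

text \<open>The infimum is not shown to be attained: joinings of arbitrarily small cost already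
  force the Lipschitz integrals to agree.\<close>

lemma rho_bar_eq_0D:
  assumes "M \<in> \<M>" "N \<in> \<M>" "rho_bar G X \<phi> M N = 0"
  shows "M = N"
proof (rule lipschitz_measure_eqI)
  show "sets M = sets B" "sets N = sets B"
    using invariant_measuresD(2) assms by auto
  interpret M: prob_space M by (rule invariant_measuresD[OF assms(1)])
  show "finite_measure M"
    by (rule M.finite_measure_axioms)
  fix h :: "'x \<Rightarrow> real" and k :: real
  assume h: "0 \<le> k" "\<And>x y. \<bar>h x - h y\<bar> \<le> k * dist x y" "\<And>x. 0 \<le> h x"
  have *: "(\<integral>\<^sup>+x. ennreal (h x) \<partial>M) \<le> (\<integral>\<^sup>+x. ennreal (h x) \<partial>N) + ennreal e \<and>
      (\<integral>\<^sup>+x. ennreal (h x) \<partial>N) \<le> (\<integral>\<^sup>+x. ennreal (h x) \<partial>M) + ennreal e" if "0 < e" for e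
  proof -
    \<comment> \<open>The denominator is \<open>k + 1\<close> because \<open>k\<close> may be
      0.\<close>
    have "rho_bar G X \<phi> M N < e / (k + 1)"
      using assms(3) \<open>0 < e\<close> h(1) by simp
    then obtain L where L: "L \<in> joinings G \<phi> M N" "cost L < e / (k + 1)"
      by (rule rho_bar_less[OF assms(1,2)])
    have "0 \<le> cost L"
      by simp
    then have "k * cost L \<le> (k + 1) * cost L"
      by (simp add: algebra_simps)
    also have "\<dots> \<le> e"
      using L(2) h(1) by (simp add: field_simps)
    finally have ke: "ennreal (k * cost L) \<le> ennreal e"
      by (rule ennreal_leI)
    note J = joiningsD[OF assms(1,2) L(1)]
    note lip = joining_lipschitz[OF assms(1,2) L(1) _ _ h(1,2,3), of "\<lambda>_. 1"]
    have "h \<in> borel_measurable N"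
      using lip(3) by (simp add: measurable_cong_sets[OF invariant_measuresD(2)[OF assms(2)] refl])
    then have "(\<integral>\<^sup>+p. ennreal (h (snd p)) \<partial>L) = (\<integral>\<^sup>+x. ennreal (h x) \<partial>N)"
      by (subst J(6)[symmetric], subst nn_integral_distr[OF J(8)]) (auto simp: J(6))
    then show ?thesis
      using lip(1,2) ke by (auto intro: order_trans add_left_mono)
  qed
  show "(\<integral>\<^sup>+x. ennreal (h x) \<partial>M) = (\<integral>\<^sup>+x. ennreal (h x) \<partial>N)"
  proof (rule order_antisym)
    show "(\<integral>\<^sup>+x. ennreal (h x) \<partial>M) \<le> (\<integral>\<^sup>+x. ennreal (h x) \<partial>N)"
      by (rule ennreal_le_epsilon) (rule *[THEN conjunct1])
    show "(\<integral>\<^sup>+x. ennreal (h x) \<partial>N) \<le> (\<integral>\<^sup>+x. ennreal (h x) \<partial>M)"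
      by (rule ennreal_le_epsilon) (rule *[THEN conjunct2])
  qed
qed

lemma rho_bar_refl:
  assumes M: "M \<in> \<M>"
  shows "rho_bar G X \<phi> M M = 0"
proof -
  note D = invariant_measuresD[OF M]
  interpret M: prob_space M by (rule D)
  define L where "L = distr M (B \<Otimes>\<^sub>M B) (\<lambda>x. (x, x))"
  note [measurable_cong] = D(2)
  have diag [measurable]: "(\<lambda>x. (x, x)) \<in> M \<rightarrow>\<^sub>M B \<Otimes>\<^sub>M B"
    by measurable
  have "L \<in> joinings G \<phi> M M"
  proof (rule joiningsI[OF M M])
    show "prob_space L"
      unfolding L_def by (rule M.prob_space_distr[OF diag])
    show "distr L (B \<Otimes>\<^sub>M B) (\<lambda>(x, z). (\<phi> g x, \<phi> g z)) = L" if g: "g \<in> carrier G" for g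
    proof -
      note [measurable] = act_measurable[OF g] D(5)[OF g]
      have "distr L (B \<Otimes>\<^sub>M B) (\<lambda>(x, z). (\<phi> g x, \<phi> g z)) = distr (distr M M (\<phi> g)) (B \<Otimes>\<^sub>M B) (\<lambda>x. (x, x))"
        unfolding L_def by (subst distr_distr, measurable)+ (auto simp: comp_def)
      then show ?thesis
        by (simp add: D(4)[OF g] L_def)
    qed
    have "distr L B fst = distr M B (\<lambda>x. x)" "distr L B snd = distr M B (\<lambda>x. x)"
      unfolding L_def by (subst distr_distr, measurable, simp add: comp_def)+
    moreover have "distr M B (\<lambda>x. x) = distr M M (\<lambda>x. x)"
      by (rule distr_cong) (simp_all add: D(2))
    ultimately show "distr L B fst = M" "distr L B snd = M"
      by simp_all
  qed (simp add: L_def)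
  moreover have "cost L = 0"
    unfolding L_def by (subst integral_distr) auto
  ultimately show ?thesis
    using rho_bar_le[OF M M] rho_bar_nonneg[of M M] by fastforce
qed

text \<open>The gluing with \<open>T\<close> and \<open>S\<close> both equal to
  \<open>\<phi> g\<close> and \<open>T'\<close> the action of the inverse. All \<open>N n\<close>
  share the sigma-algebra \<open>B\<close>, which therefore serves as the common target
  space.\<close>

lemma glue_joinings:
  assumes M: "M \<in> \<M>" and N: "\<And>n::nat. N n \<in> \<M>" and L: "\<And>n. L n \<in> joinings G \<phi> M (N n)"
  obtains K where "prob_space K" "sets K = sets (B \<Otimes>\<^sub>M PiM UNIV (\<lambda>_. B))"
    "\<forall>n. distr K (B \<Otimes>\<^sub>M B) (\<lambda>(x, y). (x, y n)) = L n"
    "\<forall>g\<in>carrier G. distr (distr K (PiM UNIV (\<lambda>_. B)) snd) (PiM UNIV (\<lambda>_. B)) (\<lambda>y n. \<phi> g (y n))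
        = distr K (PiM UNIV (\<lambda>_. B)) snd"
proof -
  note D = invariant_measuresD[OF M]
  note J = joiningsD[OF M N L]
  obtain e :: "'x \<Rightarrow> real" and r where er: "e \<in> borel_measurable B" "r \<in> borel \<rightarrow>\<^sub>M B"
      "\<And>x. x \<in> space B \<Longrightarrow> r (e x) = x" "\<And>x. x \<in> space B \<Longrightarrow> e x \<in> {0<..<1}"
    using compact_real_embedding[OF compact nonempty[OF M]] unfolding space_B by metis
  have sL: "sets (L n) = sets (M \<Otimes>\<^sub>M B)" for n
    unfolding J(2) using D(2) by (intro sets_pair_measure_cong) auto
  show thesis
  proof (rule relatively_independent_gluing[where L=L, OF D(1) J(1) sL J(5) er])
    fix K
    assume K: "prob_space K" "sets K = sets (M \<Otimes>\<^sub>M PiM UNIV (\<lambda>_. B))"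
      "\<And>n. distr K (M \<Otimes>\<^sub>M B) (\<lambda>(x, y). (x, y n)) = L n"
      and inv: "\<And>T T' S. \<lbrakk>T \<in> M \<rightarrow>\<^sub>M M; T' \<in> M \<rightarrow>\<^sub>M M; \<And>x. x \<in> space M \<Longrightarrow> T' (T x) = x; distr M M T = M;
          S \<in> B \<rightarrow>\<^sub>M B; \<And>n. distr (L n) (L n) (\<lambda>(x, y). (T x, S y)) = L n\<rbrakk> \<Longrightarrow>
          distr (distr K (PiM UNIV (\<lambda>_. B)) snd) (PiM UNIV (\<lambda>_. B)) (\<lambda>y n. S (y n)) = distr K (PiM UNIV (\<lambda>_. B)) snd"
    show thesis
    proof (rule that)
      show "prob_space K" by (rule K)
      show "sets K = sets (B \<Otimes>\<^sub>M PiM UNIV (\<lambda>_. B))"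
        unfolding K(2) using D(2) by (intro sets_pair_measure_cong) auto
      show "\<forall>n. distr K (B \<Otimes>\<^sub>M B) (\<lambda>(x, y). (x, y n)) = L n"
        unfolding K(3)[symmetric] using D(2) by (intro allI distr_cong sets_pair_measure_cong) auto
      show "\<forall>g\<in>carrier G. distr (distr K (PiM UNIV (\<lambda>_. B)) snd) (PiM UNIV (\<lambda>_. B)) (\<lambda>y n. \<phi> g (y n))
          = distr K (PiM UNIV (\<lambda>_. B)) snd"
      proof
        fix g assume g: "g \<in> carrier G"
        show "distr (distr K (PiM UNIV (\<lambda>_. B)) snd) (PiM UNIV (\<lambda>_. B)) (\<lambda>y n. \<phi> g (y n))
            = distr K (PiM UNIV (\<lambda>_. B)) snd"
          by (rule inv[OF D(5)[OF g] D(5)[OF inv_carrier[OF g]] _ D(4)[OF g] act_measurable[OF g] J(4)[OF g]])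
            (simp add: D(3) act_inv[OF g])
      qed
    qed
  qed
qed

text \<open>Nearly optimal joinings are glued over the middle measure \<open>N\<close>; the outer
  coordinates then form a joining of \<open>M\<close> and \<open>P\<close>, and the triangle
  inequality is integrated.\<close>

lemma rho_bar_triangle:
  assumes M: "M \<in> \<M>" and N: "N \<in> \<M>" and P: "P \<in> \<M>"
  shows "rho_bar G X \<phi> M P \<le> rho_bar G X \<phi> M N + rho_bar G X \<phi> N P"
proof (rule field_le_epsilon)
  fix e :: real assume "0 < e"
  then have less: "r < r + e / 2" for r
    by simp
  obtain L1 where L1: "L1 \<in> joinings G \<phi> M N" "cost L1 < rho_bar G X \<phi> M N + e / 2"
    by (rule rho_bar_less[OF M N less])
  obtain L2 where L2: "L2 \<in> joinings G \<phi> N P" "cost L2 < rho_bar G X \<phi> N P + e / 2"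
    by (rule rho_bar_less[OF N P less])
  define L1' where "L1' = distr L1 (B \<Otimes>\<^sub>M B) (\<lambda>p. (snd p, fst p))"
  have L1': "L1' \<in> joinings G \<phi> N M" "cost L1' = cost L1"
    using swap_joining[OF M N L1(1)] by (simp_all add: L1'_def)
  \<comment> \<open>The gluing expects a whole sequence: index 0 carries the first joining, all
    other indices carry the second, and only coordinates 0 and 1 are used.\<close>
  define LL where "LL n = (if n = 0 then L1' else L2)" for n :: nat
  define NN where "NN n = (if n = 0 then M else P)" for n :: nat
  have LL: "LL n \<in> joinings G \<phi> N (NN n)" for n
    using L1' L2 by (simp add: LL_def NN_def)
  have NN: "NN n \<in> \<M>" for n
    using M P by (simp add: NN_def)
  obtain K where K: "prob_space K" "sets K = sets (B \<Otimes>\<^sub>M PiM UNIV (\<lambda>_::nat. B))"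
    "\<forall>n. distr K (B \<Otimes>\<^sub>M B) (\<lambda>(x, y). (x, y n)) = LL n"
    "\<forall>g\<in>carrier G. distr (distr K (PiM UNIV (\<lambda>_. B)) snd) (PiM UNIV (\<lambda>_. B)) (\<lambda>y n. \<phi> g (y n))
        = distr K (PiM UNIV (\<lambda>_. B)) snd"
    by (rule glue_joinings[where L=LL and N=NN, OF N NN LL])
  interpret K: prob_space K by (rule K)
  let ?P = "PiM UNIV (\<lambda>_::nat. B)"
  note [measurable_cong] = K(2)
  have marg: "distr K (B \<Otimes>\<^sub>M B) (\<lambda>p. (fst p, snd p n)) = LL n" for n
    using K(3) by (simp add: case_prod_beta')
  have [measurable]: "(\<lambda>y. y n) \<in> ?P \<rightarrow>\<^sub>M B" for n
    by measurable
  have [measurable]: "(\<lambda>p. snd p n) \<in> K \<rightarrow>\<^sub>M B" for n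
    by measurable
  define L where "L = distr (distr K ?P snd) (B \<Otimes>\<^sub>M B) (\<lambda>y. (y 0, y 1))"
  have L_K: "L = distr K (B \<Otimes>\<^sub>M B) (\<lambda>p. (snd p 0, snd p 1))"
    unfolding L_def by (subst distr_distr) (auto simp: comp_def)
  have "L \<in> joinings G \<phi> M P"
  proof (rule joiningsI[OF M P])
    show "prob_space L"
      unfolding L_K by (rule K.prob_space_distr) measurable
    show "sets L = sets (B \<Otimes>\<^sub>M B)"
      by (simp add: L_def)
    show "distr L (B \<Otimes>\<^sub>M B) (\<lambda>(x, z). (\<phi> g x, \<phi> g z)) = L" if g: "g \<in> carrier G" for g
    proof -
      note [measurable] = act_measurable[OF g]
      have [measurable]: "(\<lambda>y n. \<phi> g (y n)) \<in> ?P \<rightarrow>\<^sub>M ?P"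
        by (rule measurable_PiM_single') (auto simp: space_PiM intro: measurable_space[OF act_measurable[OF g]])
      have "distr L (B \<Otimes>\<^sub>M B) (\<lambda>(x, z). (\<phi> g x, \<phi> g z))
          = distr (distr (distr K ?P snd) ?P (\<lambda>y n. \<phi> g (y n))) (B \<Otimes>\<^sub>M B) (\<lambda>y. (y 0, y 1))"
        unfolding L_def by (subst (1 2) distr_distr) (auto simp: comp_def)
      then show ?thesis
        by (simp add: K(4)[rule_format, OF g] L_def)
    qed
    have LL_snd: "distr (LL n) B snd = NN n" for n
      using joiningsD(6)[OF N NN[of n] LL[of n]] distr_cong[OF refl invariant_measuresD(2)[OF NN[of n]], of "LL n" snd snd] by simp
    have "distr K B (\<lambda>p. snd p n) = distr (LL n) B snd" for n
      unfolding marg[symmetric] by (subst distr_distr) (auto simp: comp_def)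
    moreover have "distr L B fst = distr K B (\<lambda>p. snd p 0)" "distr L B snd = distr K B (\<lambda>p. snd p 1)"
      unfolding L_K by (subst distr_distr; auto simp: comp_def)+
    ultimately show "distr L B fst = M" "distr L B snd = P"
      using LL_snd by (simp_all add: NN_def)
  qed
  have d [measurable]: "(\<lambda>p. dist (fst p) (snd p n)) \<in> borel_measurable K" for n
    using measurable_compose[of "\<lambda>p. (fst p, snd p n)" K "B \<Otimes>\<^sub>M B", OF _ dist_meas_B] by simp
  have d01: "integrable K (\<lambda>p. dist (snd p 0) (snd p 1))" "cost L = (\<integral>p. dist (snd p 0) (snd p 1) \<partial>K)"
  proof -
    have "prob_space L" "sets L = sets (B \<Otimes>\<^sub>M B)"
      unfolding L_K by (auto intro!: K.prob_space_distr)
    from integrable_dist(1)[OF this] show "integrable K (\<lambda>p. dist (snd p 0) (snd p 1))"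
      unfolding L_K by (subst (asm) integrable_distr_eq) auto
    show "cost L = (\<integral>p. dist (snd p 0) (snd p 1) \<partial>K)"
      unfolding L_K by (subst integral_distr) auto
  qed
  have dn: "integrable K (\<lambda>p. dist (fst p) (snd p n))" "cost (LL n) = (\<integral>p. dist (fst p) (snd p n) \<partial>K)" for n
  proof -
    note J = joiningsD[OF N NN[of n] LL[of n]]
    from integrable_dist(1)[OF J(1,2)] show "integrable K (\<lambda>p. dist (fst p) (snd p n))"
      unfolding marg[symmetric] by (subst (asm) integrable_distr_eq) auto
    show "cost (LL n) = (\<integral>p. dist (fst p) (snd p n) \<partial>K)"
      unfolding marg[symmetric] by (subst integral_distr) auto
  qed
  have "cost L \<le> (\<integral>p. dist (fst p) (snd p 0) + dist (fst p) (snd p 1) \<partial>K)"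
    unfolding d01(2) using d01(1) dn(1) by (intro integral_mono) (auto simp: dist_triangle3)
  also have "\<dots> = cost (LL 0) + cost (LL 1)"
    unfolding dn(2) using dn(1) by simp
  finally have "cost L \<le> cost L1 + cost L2"
    by (simp add: LL_def L1')
  with rho_bar_le[OF M P \<open>L \<in> joinings G \<phi> M P\<close>] L1(2) L2(2)
  show "rho_bar G X \<phi> M P \<le> rho_bar G X \<phi> M N + rho_bar G X \<phi> N P + e"
    by simp
qed

lemma Metric_space_rho_bar: "Metric_space \<M> (rho_bar G X \<phi>)"
proof
  show "0 \<le> rho_bar G X \<phi> M N" for M N
    by (rule rho_bar_nonneg)
  show "rho_bar G X \<phi> M N = rho_bar G X \<phi> N M" for M N
    using rho_bar_commute_le[of M N] rho_bar_commute_le[of N M] by (fastforce simp: rho_bar_def)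
  show "rho_bar G X \<phi> M N = 0 \<longleftrightarrow> M = N" if "M \<in> \<M>" "N \<in> \<M>" for M N
    using rho_bar_eq_0D[OF that] rho_bar_refl[OF that(1)] by auto
  show "rho_bar G X \<phi> M P \<le> rho_bar G X \<phi> M N + rho_bar G X \<phi> N P" if "M \<in> \<M>" "N \<in> \<M>" "P \<in> \<M>" for M N P
    by (rule rho_bar_triangle[OF that])
qed

end

section \<open>Limits of ergodic measures\<close>

context compact_action
begin

text \<open>After a swap, \<open>F\<close> is the conditional probability of \<open>A\<close> given
  the second coordinate. It is shown to be constant, and the constant must then be its mean, the
  measure of \<open>A\<close>.\<close>

lemma ergodic_joining_independent:
  assumes M: "M \<in> \<M>" and N: "N \<in> \<M>" and L: "L \<in> joinings G \<phi> M N" and "ergodic G \<phi> N"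
    and A: "A \<in> sets M" "\<And>g. g \<in> carrier G \<Longrightarrow> \<phi> g -` A \<inter> space M = A"
    and E: "E \<in> sets N"
  shows "emeasure L (A \<times> E) = emeasure M A * emeasure N E"
proof -
  interpret group_action G X \<phi> by (rule action)
  interpret G: group G by (rule group)
  note DM = invariant_measuresD[OF M] and DN = invariant_measuresD[OF N]
  interpret N: prob_space N by (rule DN)
  interpret M: prob_space M by (rule DM)
  note J = joiningsD[OF M N L]
  define L' where "L' = distr L (B \<Otimes>\<^sub>M B) (\<lambda>p. (snd p, fst p))"
  have L': "L' \<in> joinings G \<phi> N M"
    unfolding L'_def by (rule swap_joining[OF M N L])
  note J' = joiningsD[OF N M L']
  have sL': "sets L' = sets (N \<Otimes>\<^sub>M M)"
    unfolding J'(2) using DM(2) DN(2) by (intro sets_pair_measure_cong) auto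
  have swap: "emeasure L' (E' \<times> A) = emeasure L (A \<times> E')" if E': "E' \<in> sets N" for E'
  proof -
    have "E' \<times> A \<in> sets (B \<Otimes>\<^sub>M B)"
      using E' A(1) by (simp add: DM(2) DN(2))
    moreover have "(\<lambda>p. (snd p, fst p)) \<in> L \<rightarrow>\<^sub>M B \<Otimes>\<^sub>M B"
      unfolding measurable_cong_sets[OF J(2) refl] by measurable
    moreover have "(\<lambda>p. (snd p, fst p)) -` (E' \<times> A) \<inter> space L = A \<times> E'"
      using sets.sets_into_space[OF A(1)] sets.sets_into_space[OF E'] by (auto simp: J(3) DM(3) DN(3))
    ultimately show ?thesis
      unfolding L'_def by (simp add: emeasure_distr)
  qed
  obtain F where F: "F \<in> borel_measurable N" "\<And>E. E \<in> sets N \<Longrightarrow> (\<integral>\<^sup>+x\<in>E. F x \<partial>N) = emeasure L' (E \<times> A)"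
    using section_density[OF N.sigma_finite_measure_axioms sL' J'(5) A(1)] by blast
  have F_inv: "AE x in N. F (\<phi> g x) = F x" if g: "g \<in> carrier G" for g
  proof -
    \<comment> \<open>Since \<open>A\<close> equals its preimage under \<open>\<phi> g\<close>, the
      same \<open>F\<close> is a density for both sets, so equivariance of densities becomes
      invariance of \<open>F\<close>.\<close>
    have F2: "(\<integral>\<^sup>+x\<in>E. F x \<partial>N) = emeasure L' (E \<times> (\<phi> g -` A \<inter> space M))" if "E \<in> sets N" for E
      unfolding A(2)[OF g] by (rule F(2)[OF that])
    show ?thesis
      by (rule section_density_equivariant[OF N.sigma_finite_measure_axioms sL' F F(1) F2 A(1)
            DN(5)[OF g] DN(5)[OF inv_carrier[OF g]] _ DN(4)[OF g] DM(5)[OF g] J'(4)[OF g]])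
        (simp_all add: DN(3) act_inv[OF g])
  qed
  \<comment> \<open>The supremum over the orbit is invariant at every point, measurable because the
    group is countable, and almost everywhere equal to \<open>F\<close>.\<close>
  define F' where "F' x = (SUP g\<in>carrier G. F (\<phi> g x))" for x
  have F'_meas [measurable]: "F' \<in> borel_measurable N"
    unfolding F'_def using countable_carrier measurable_compose[OF DN(5) F(1)]
    by (intro borel_measurable_SUP) auto
  have F'_F: "AE x in N. F' x = F x"
  proof -
    have "AE x in N. \<forall>g\<in>carrier G. F (\<phi> g x) = F x"
      using countable_carrier F_inv by (simp add: AE_ball_countable)
    then show ?thesis
    proof eventually_elim
      case (elim x)
      then have "F' x = (SUP g\<in>carrier G. F x)"
        unfolding F'_def by (intro SUP_cong) auto
      moreover have "carrier G \<noteq> {}"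
        using G.one_closed by blast
      ultimately show ?case by simp
    qed
  qed
  have F'_inv: "F' (\<phi> h x) = F' x" if h: "h \<in> carrier G" and x: "x \<in> X" for h x
  proof -
    have comp: "\<phi> g (\<phi> h x) = \<phi> (g \<otimes>\<^bsub>G\<^esub> h) x" if "g \<in> carrier G" for g
      using composition_rule[OF x that h] by simp
    show ?thesis
      unfolding F'_def
    proof (rule SUP_eq)
      fix g assume g: "g \<in> carrier G"
      show "\<exists>j\<in>carrier G. F (\<phi> g (\<phi> h x)) \<le> F (\<phi> j x)"
        by (rule bexI[of _ "g \<otimes>\<^bsub>G\<^esub> h"]) (use g h comp in auto)
      show "\<exists>i\<in>carrier G. F (\<phi> g x) \<le> F (\<phi> i (\<phi> h x))"
        by (rule bexI[of _ "g \<otimes>\<^bsub>G\<^esub> inv\<^bsub>G\<^esub> h"]) (use g h comp in \<open>auto simp: G.m_assoc\<close>)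
    qed
  qed
  let ?a = "emeasure M A"
  have int_F': "integral\<^sup>N N F' = ?a"
  proof -
    have "integral\<^sup>N N F' = (\<integral>\<^sup>+x\<in>space N. F x \<partial>N)"
      using F'_F by (intro nn_integral_cong_AE) (auto elim!: AE_mp)
    also have "\<dots> = emeasure L' (space N \<times> A)"
      by (rule F(2)) simp
    also have "\<dots> = emeasure L (A \<times> space N)"
      by (rule swap) simp
    also have "\<dots> = ?a"
      using emeasure_Times_le_marginal(2)[of L M N, OF _ J(5) A(1)] DM(2) DN(2) J(2)
      by (simp cong: sets_pair_measure_cong)
    finally show ?thesis .
  qed
  have a_fin: "?a < \<infinity>"
    by (simp add: M.emeasure_finite less_top[symmetric])
  have int_a: "(\<integral>\<^sup>+x. ?a \<partial>N) = ?a"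
    by (simp add: N.emeasure_space_1)
  \<comment> \<open>Only the set above the mean has to be examined. It cannot have full measure, so
    ergodicity makes it null; then \<open>F'\<close> lies below its mean almost everywhere and hence
    equals it.\<close>
  define S where "S = {x \<in> space N. ?a < F' x}"
  have S [measurable]: "S \<in> sets N"
    unfolding S_def by measurable
  have "\<forall>g\<in>carrier G. \<phi> g -` S \<inter> space N = S"
    using F'_inv act_X by (auto simp: S_def DN(3))
  then have "measure N S = 0 \<or> measure N S = 1"
    using assms(4) S by (simp add: ergodic_def)
  moreover have "measure N S \<noteq> 1"
  proof
    assume "measure N S = 1"
    then have lt: "AE x in N. ?a < F' x"
      using N.AE_in_set_eq_1[OF S] by (auto simp: S_def elim!: AE_mp)
    have "AE x in N. ?a = F' x"
      using lt int_F' int_a a_fin by (intro AE_eq_of_nn_integral_le) (auto elim!: AE_mp)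
    with lt have "AE x in N. False"
      by eventually_elim simp
    then show False by simp
  qed
  ultimately have "AE x in N. x \<notin> S"
    using N.prob_eq_0[OF S] by blast
  then have le: "AE x in N. F' x \<le> ?a"
    using AE_space by eventually_elim (auto simp: S_def)
  have "AE x in N. F' x = ?a"
    using le int_F' int_a a_fin by (intro AE_eq_of_nn_integral_le) auto
  with F'_F have F_const: "AE x in N. F x = ?a"
    by eventually_elim simp
  have "emeasure L (A \<times> E) = (\<integral>\<^sup>+x\<in>E. F x \<partial>N)"
    by (simp add: F(2)[OF E] swap[OF E])
  also have "\<dots> = (\<integral>\<^sup>+x. ?a * indicator E x \<partial>N)"
    using F_const by (intro nn_integral_cong_AE) (auto elim!: AE_mp)
  also have "\<dots> = ?a * emeasure N E"
    using E by (simp add: nn_integral_cmult_indicator)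
  finally show ?thesis .
qed

text \<open>Passes from sets to functions through an equality of measures: \<open>L\<close>
  restricted to first coordinates in \<open>A\<close> projects to a multiple of
  \<open>N\<close>.\<close>

lemma ergodic_joining_integral:
  assumes M: "M \<in> \<M>" and N: "N \<in> \<M>" and L: "L \<in> joinings G \<phi> M N" and "ergodic G \<phi> N"
    and A: "A \<in> sets M" "\<And>g. g \<in> carrier G \<Longrightarrow> \<phi> g -` A \<inter> space M = A"
    and h: "h \<in> borel_measurable N"
  shows "(\<integral>\<^sup>+p. indicator A (fst p) * h (snd p) \<partial>L) = emeasure M A * (\<integral>\<^sup>+z. h z \<partial>N)"
proof -
  note J = joiningsD[OF M N L]
  note [measurable] = J(7,8) A(1) h
  have ind [measurable]: "(\<lambda>p. indicator A (fst p) :: ennreal) \<in> borel_measurable L"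
    by measurable
  have "distr (density L (\<lambda>p. indicator A (fst p))) N snd = density N (\<lambda>_. emeasure M A)"
  proof (rule measure_eqI)
    fix E assume "E \<in> sets (distr (density L (\<lambda>p. indicator A (fst p))) N snd)"
    then have E [measurable]: "E \<in> sets N" by simp
    have AE_sets: "A \<times> E \<in> sets L"
      using A(1) E by (simp add: J(2) invariant_measuresD(2)[OF M] invariant_measuresD(2)[OF N])
    have "emeasure (distr (density L (\<lambda>p. indicator A (fst p))) N snd) E
        = (\<integral>\<^sup>+p. indicator A (fst p) * indicator (snd -` E \<inter> space L) p \<partial>L)"
      by (subst emeasure_distr; simp add: emeasure_density)
    also have "\<dots> = (\<integral>\<^sup>+p. indicator (A \<times> E) p \<partial>L)"
      by (intro nn_integral_cong) (auto simp: indicator_def)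
    also have "\<dots> = emeasure M A * emeasure N E"
      using AE_sets ergodic_joining_independent[OF assms(1-6) E] by simp
    also have "\<dots> = emeasure (density N (\<lambda>_. emeasure M A)) E"
      by (simp add: emeasure_density nn_integral_cmult_indicator)
    finally show "emeasure (distr (density L (\<lambda>p. indicator A (fst p))) N snd) E
        = emeasure (density N (\<lambda>_. emeasure M A)) E" .
  qed simp
  then have "(\<integral>\<^sup>+z. h z \<partial>distr (density L (\<lambda>p. indicator A (fst p))) N snd) = (\<integral>\<^sup>+z. h z \<partial>density N (\<lambda>_. emeasure M A))"
    by simp
  then show ?thesis
    by (simp add: nn_integral_distr nn_integral_density nn_integral_cmult)
qed

lemma ergodic_closed:
  assumes M: "M \<in> \<M>" and approx: "\<And>r. 0 < r \<Longrightarrow> \<exists>N\<in>\<M>. ergodic G \<phi> N \<and> rho_bar G X \<phi> M N < r"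
  shows "ergodic G \<phi> M"
  unfolding ergodic_def
proof (intro ballI impI)
  fix A assume A: "A \<in> sets M" and "\<forall>g\<in>carrier G. \<phi> g -` A \<inter> space M = A"
  then have A_inv: "\<And>g. g \<in> carrier G \<Longrightarrow> \<phi> g -` A \<inter> space M = A"
    by blast
  note D = invariant_measuresD[OF M]
  interpret M: prob_space M by (rule D)
  let ?a = "emeasure M A"
  have a1: "?a \<le> 1"
    by (rule M.emeasure_le_1)
  have indA: "(indicator A :: 'x \<Rightarrow> ennreal) \<in> borel_measurable B"
    using A by (simp add: D(2))
  have "density M (indicator A) = density M (\<lambda>_. ?a)"
  proof (rule lipschitz_measure_eqI)
    show "finite_measure (density M (indicator A))"
      using A by (intro finite_measureI) (simp add: emeasure_density M.emeasure_finite)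
    show "sets (density M (indicator A)) = sets B" "sets (density M (\<lambda>_. ?a)) = sets B"
      by (simp_all add: D(2))
    fix h :: "'x \<Rightarrow> real" and k :: real
    assume h: "0 \<le> k" "\<And>x y. \<bar>h x - h y\<bar> \<le> k * dist x y" "\<And>x. 0 \<le> h x"
    let ?I = "\<integral>\<^sup>+x. indicator A x * ennreal (h x) \<partial>M" and ?J = "\<integral>\<^sup>+x. ennreal (h x) \<partial>M"
    have *: "?I \<le> ?a * ?J + ennreal e \<and> ?a * ?J \<le> ?I + ennreal e" if "0 < e" for e
    proof -
      \<comment> \<open>The test function is moved between the coordinates twice, once weighted by
        the indicator of \<open>A\<close> and once unweighted, at \<open>k\<close> times the cost
        each time. The added 1 covers \<open>k = 0\<close>.\<close>
      have "0 < e / (2 * k + 1)"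
        using \<open>0 < e\<close> h(1) by simp
      from approx[OF this] obtain N where N: "N \<in> \<M>" "ergodic G \<phi> N" "rho_bar G X \<phi> M N < e / (2 * k + 1)"
        by blast
      obtain L where L: "L \<in> joinings G \<phi> M N" "cost L < e / (2 * k + 1)"
        by (rule rho_bar_less[OF M N(1,3)])
      note J = joiningsD[OF M N(1) L(1)]
      define c where "c = ennreal (k * cost L)"
      have "0 \<le> cost L"
        by simp
      then have "2 * k * cost L \<le> (2 * k + 1) * cost L"
        by (simp add: algebra_simps)
      also have "\<dots> \<le> e"
        using L(2) h(1) by (simp add: field_simps)
      finally have "ennreal (k * cost L + k * cost L) \<le> ennreal e"
        by (intro ennreal_leI) simp
      then have cc: "c + c \<le> ennreal e"
        unfolding c_def using h(1) \<open>0 \<le> cost L\<close> by (subst (asm) ennreal_plus) auto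
      let ?Q = "\<integral>\<^sup>+p. indicator A (fst p) * ennreal (h (snd p)) \<partial>L" and ?JN = "\<integral>\<^sup>+x. ennreal (h x) \<partial>N"
      have I: "?I \<le> ?Q + c" "?Q \<le> ?I + c" "h \<in> borel_measurable B"
        unfolding c_def
        by (rule joining_lipschitz[OF M N(1) L(1) indA _ h]; simp add: indicator_def)+
      have hN: "h \<in> borel_measurable N"
        using I(3) by (simp add: measurable_cong_sets[OF invariant_measuresD(2)[OF N(1)] refl])
      have "(\<integral>\<^sup>+p. ennreal (h (snd p)) \<partial>L) = ?JN"
        using hN by (subst J(6)[symmetric], subst nn_integral_distr[OF J(8)]) (auto simp: J(6))
      then have J2: "?J \<le> ?JN + c" "?JN \<le> ?J + c"
        unfolding c_def using joining_lipschitz(1,2)[OF M N(1) L(1) _ _ h, of "\<lambda>_. 1"] by simp_all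
      have Q: "?Q = ?a * ?JN"
        using hN by (intro ergodic_joining_integral[OF M N(1) L(1) N(2) A A_inv]) auto
      have ac: "?a * c \<le> c"
        using mult_right_mono[OF a1, of c] by simp
      have "?I \<le> ?a * (?J + c) + c"
        using I(1) J2(2) unfolding Q by (meson add_right_mono mult_left_mono order_trans zero_le)
      also have "\<dots> \<le> ?a * ?J + (c + c)"
        using ac by (simp add: distrib_left add.assoc add_mono)
      finally have 1: "?I \<le> ?a * ?J + ennreal e"
        using cc by (meson add_left_mono order_trans)
      have "?a * ?J \<le> ?a * (?JN + c)"
        using J2(1) by (intro mult_left_mono) auto
      also have "\<dots> \<le> ?Q + c"
        unfolding Q using ac by (simp add: distrib_left)
      also have "\<dots> \<le> ?I + c + c"
        using I(2) by (intro add_right_mono)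
      finally have 2: "?a * ?J \<le> ?I + ennreal e"
        using cc unfolding add.assoc by (meson add_left_mono order_trans)
      from 1 2 show ?thesis ..
    qed
    have "?I = ?a * ?J"
    proof (rule order_antisym)
      show "?I \<le> ?a * ?J"
        by (rule ennreal_le_epsilon) (rule *[THEN conjunct1])
      show "?a * ?J \<le> ?I"
        by (rule ennreal_le_epsilon) (rule *[THEN conjunct2])
    qed
    moreover have "h \<in> borel_measurable M"
      using joining_lipschitz(3)[OF M M product_joining[OF M M] _ _ h, of "\<lambda>_. 1"]
      by (simp add: measurable_cong_sets[OF D(2) refl])
    ultimately show "(\<integral>\<^sup>+x. ennreal (h x) \<partial>density M (indicator A)) = (\<integral>\<^sup>+x. ennreal (h x) \<partial>density M (\<lambda>_. ?a))"
      using A by (simp add: nn_integral_density nn_integral_cmult)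
  qed
  \<comment> \<open>Evaluating the equality of measures at \<open>A\<close> itself says that its
    measure equals its own square.\<close>
  then have "emeasure (density M (indicator A)) A = emeasure (density M (\<lambda>_. ?a)) A"
    by simp
  then have "?a = ?a * ?a"
    using A by (simp add: emeasure_density nn_integral_cmult_indicator flip: indicator_inter_arith)
  then have "ennreal (M.prob A) = ennreal (M.prob A * M.prob A)"
    by (simp add: M.emeasure_eq_measure ennreal_mult)
  then have "M.prob A = M.prob A * M.prob A"
    by simp
  then show "M.prob A = 0 \<or> M.prob A = 1"
    by simp
qed

end

section \<open>Limits of systems in a characteristic class\<close>

context compact_action
begin

text \<open>The expected sum of all distances is bounded by a geometric series, so the sum is finite
  almost surely and its terms tend to 0.\<close>

lemma glued_converge_AE:
  assumes K: "prob_space K" "sets K = sets (B \<Otimes>\<^sub>M PiM UNIV (\<lambda>_::nat. B))"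
    and marg: "\<And>n. distr K (B \<Otimes>\<^sub>M B) (\<lambda>(x, y). (x, y n)) = L n"
    and prob: "\<And>n. prob_space (L n)" and cost: "\<And>n. cost (L n) \<le> (1 / 2) ^ n"
  shows "AE p in K. snd p \<longlonglongrightarrow> fst p"
proof -
  interpret K: prob_space K by (rule K)
  note [measurable_cong] = K(2)
  have pair [measurable]: "(\<lambda>p. (fst p, snd p n)) \<in> K \<rightarrow>\<^sub>M B \<Otimes>\<^sub>M B" for n
    by measurable
  have d [measurable]: "(\<lambda>p. dist (fst p) (snd p n)) \<in> borel_measurable K" for n
    using measurable_compose[OF pair dist_meas_B] by simp
  have dK: "(\<integral>\<^sup>+p. ennreal (dist (fst p) (snd p n)) \<partial>K) \<le> ennreal ((1 / 2) ^ n)" for n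
  proof -
    have L: "L n = distr K (B \<Otimes>\<^sub>M B) (\<lambda>p. (fst p, snd p n))"
      by (simp add: marg[of n, symmetric] case_prod_beta')
    have "(\<integral>\<^sup>+p. ennreal (dist (fst p) (snd p n)) \<partial>K) = (\<integral>\<^sup>+p. ennreal (dist (fst p) (snd p)) \<partial>L n)"
      unfolding L by (subst nn_integral_distr) auto
    also have "\<dots> = ennreal (cost (L n))"
      by (rule integrable_dist(2)[OF prob]) (simp add: L)
    finally show ?thesis
      using cost[of n] by (simp add: ennreal_leI)
  qed
  have "(\<integral>\<^sup>+p. (\<Sum>n. ennreal (dist (fst p) (snd p n))) \<partial>K) = (\<Sum>n. \<integral>\<^sup>+p. ennreal (dist (fst p) (snd p n)) \<partial>K)"
    by (rule nn_integral_suminf) measurable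
  also have "\<dots> \<le> (\<Sum>n. ennreal ((1 / 2) ^ n))"
    by (intro suminf_le dK) auto
  also have "\<dots> < \<infinity>"
    by (subst suminf_ennreal2) (auto simp: summable_geometric)
  finally have "AE p in K. (\<Sum>n. ennreal (dist (fst p) (snd p n))) \<noteq> \<infinity>"
    by (intro nn_integral_PInf_AE) auto
  then show ?thesis
  proof eventually_elim
    case (elim p)
    then have "summable (\<lambda>n. dist (fst p) (snd p n))"
      by (intro summable_suminf_not_top) auto
    then have "(\<lambda>n. dist (snd p n) (fst p)) \<longlonglongrightarrow> 0"
      by (subst dist_commute) (rule summable_LIMSEQ_zero)
    then show ?case
      by (subst tendsto_dist_iff)
  qed
qed

text \<open>Joinings in the class are formed from real models, and membership of a joining is again
  only up to isomorphism. The limit map is therefore conjugated: from the real model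
  \<open>R\<close> to the joining \<open>J\<close> of the models \<open>Ms n\<close>, on to
  sequences in \<open>X\<close>, to their limit, and back to a real point.\<close>

lemma in_class_limit:
  assumes \<C>: "characteristic_class G \<C>" and M: "M \<in> \<M>" and N: "\<And>n::nat. N n \<in> \<M>"
    and cls: "\<And>n. in_class G \<C> (N n) \<phi>"
    and L: "\<And>n. L n \<in> joinings G \<phi> M (N n)" and cost: "\<And>n. cost (L n) \<le> (1 / 2) ^ n"
  shows "in_class G \<C> M \<phi>"
proof -
  note D = invariant_measuresD[OF M]
  note DN = invariant_measuresD[OF N]
  interpret M: prob_space M by (rule D)
  let ?P = "PiM UNIV (\<lambda>_::nat. B)"
  have "\<exists>R S. (R, S) \<in> \<C> \<and> isomorphic_systems G (N n) \<phi> R S" for n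
    using cls[of n] unfolding in_class_def by blast
  then obtain Ms Ts where MsC: "\<And>n. (Ms n, Ts n) \<in> \<C>" and iso: "\<And>n. isomorphic_systems G (N n) \<phi> (Ms n) (Ts n)"
    by metis
  have sys: "mp_system G (Ms n) (Ts n)" for n
    using \<C> MsC[of n] unfolding characteristic_class_def by blast
  have Ts_meas: "Ts n g \<in> Ms n \<rightarrow>\<^sub>M Ms n" if "g \<in> carrier G" for n g
    using sys[of n] that by (simp add: mp_system_def)
  obtain f where f_N: "\<And>n. f n \<in> N n \<rightarrow>\<^sub>M Ms n" and f_bij: "\<And>n. bij_betw (f n) (space (N n)) (space (Ms n))"
      and f_inv: "\<And>n. inv_into (space (N n)) (f n) \<in> Ms n \<rightarrow>\<^sub>M N n" and f_distr: "\<And>n. distr (N n) (Ms n) (f n) = Ms n"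
      and f_eq: "\<And>n. \<forall>g\<in>carrier G. \<forall>x\<in>space (N n). f n (\<phi> g x) = Ts n g (f n x)"
    using iso unfolding isomorphic_systems_def by metis
  define fi where "fi n = inv_into X (f n)" for n
  have f [measurable]: "f n \<in> B \<rightarrow>\<^sub>M Ms n" for n
    using f_N[of n] by (simp add: measurable_cong_sets[OF DN(2) refl])
  have fi [measurable]: "fi n \<in> Ms n \<rightarrow>\<^sub>M B" for n
    using f_inv[of n] by (simp add: fi_def DN(3) measurable_cong_sets[OF refl DN(2)])
  have fi_f: "fi n (f n x) = x" if "x \<in> X" for n x
    using bij_betw_inv_into_left[OF f_bij[of n]] that by (simp add: fi_def DN(3))
  have f_fi: "f n (fi n z) = z" if "z \<in> space (Ms n)" for n z
    using bij_betw_inv_into_right[OF f_bij[of n] that] by (simp add: fi_def DN(3))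
  have fi_X: "fi n z \<in> X" if "z \<in> space (Ms n)" for n z
    using measurable_space[OF fi that] by (simp add: space_B)
  have f_equiv: "f n (\<phi> g x) = Ts n g (f n x)" if "g \<in> carrier G" "x \<in> X" for n g x
    using f_eq[of n] that by (simp add: DN(3))

  obtain K where K: "prob_space K" "sets K = sets (B \<Otimes>\<^sub>M ?P)"
    "\<forall>n. distr K (B \<Otimes>\<^sub>M B) (\<lambda>(x, y). (x, y n)) = L n"
    "\<forall>g\<in>carrier G. distr (distr K ?P snd) ?P (\<lambda>y n. \<phi> g (y n)) = distr K ?P snd"
    by (rule glue_joinings[where L=L and N=N, OF M N L])
  interpret K: prob_space K by (rule K)
  note [measurable_cong] = K(2)
  have conv: "AE p in K. snd p \<longlonglongrightarrow> fst p"
    using glued_converge_AE[OF K(1,2) K(3)[rule_format] joiningsD(1)[OF M N L] cost] .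
  define \<kappa> where "\<kappa> = distr K ?P snd"
  have snd_K [measurable]: "snd \<in> K \<rightarrow>\<^sub>M ?P" and fst_K [measurable]: "fst \<in> K \<rightarrow>\<^sub>M B"
    by measurable
  have \<kappa>_sets [simp, measurable_cong]: "sets \<kappa> = sets ?P"
    by (simp add: \<kappa>_def)
  have P_X: "y n \<in> X" if "y \<in> space ?P" for y n
    using that by (auto simp: space_PiM space_B)
  interpret \<kappa>: prob_space \<kappa>
    unfolding \<kappa>_def by (rule K.prob_space_distr) measurable
  have coord [measurable]: "(\<lambda>y. y n) \<in> ?P \<rightarrow>\<^sub>M B" for n
    by measurable
  have K_fst: "distr K B fst = M"
  proof -
    have "distr K B fst = distr (L 0) B fst"
      unfolding K(3)[rule_format, symmetric] by (subst distr_distr) (auto simp: comp_def case_prod_beta')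
    also have "\<dots> = distr (L 0) M fst"
      by (rule distr_cong) (simp_all add: D(2))
    finally show ?thesis
      by (simp add: joiningsD(5)[OF M N L])
  qed
  have \<kappa>_coord: "distr \<kappa> B (\<lambda>y. y n) = N n" for n
  proof -
    have "distr \<kappa> B (\<lambda>y. y n) = distr (L n) B snd"
      unfolding \<kappa>_def K(3)[rule_format, symmetric] by (subst (1 2) distr_distr) (auto simp: comp_def case_prod_beta')
    also have "\<dots> = distr (L n) (N n) snd"
      by (rule distr_cong) (simp_all add: DN(2))
    finally show ?thesis
      by (simp add: joiningsD(6)[OF M N L])
  qed

  let ?Q = "PiM UNIV Ms"
  define F where "F y = (\<lambda>n. f n (y n))" for y
  define Fi where "Fi z = (\<lambda>n. fi n (z n))" for z
  have F [measurable]: "F \<in> ?P \<rightarrow>\<^sub>M ?Q"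
    unfolding F_def by (rule measurable_PiM_single') (auto simp: space_PiM intro: measurable_space[OF f])
  have Fi [measurable]: "Fi \<in> ?Q \<rightarrow>\<^sub>M ?P"
    unfolding Fi_def by (rule measurable_PiM_single') (auto simp: space_PiM intro: measurable_space[OF fi])
  have Fi_F: "Fi (F y) = y" if "y \<in> space ?P" for y
    using P_X[OF that] by (simp add: Fi_def F_def fi_f)
  define J where "J = distr \<kappa> ?Q F"
  have J_sets [simp, measurable_cong]: "sets J = sets ?Q"
    by (simp add: J_def)
  have J_space: "space J = space ?Q"
    by (simp add: J_def)
  have Q_coord: "z n \<in> space (Ms n)" if "z \<in> space ?Q" for z n
    using that by (auto simp: space_PiM)
  let ?T = "product_action UNIV Ms Ts"
  have T_eq: "?T g z = (\<lambda>n. Ts n g (z n))" if "z \<in> space ?Q" for g z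
    using that by (simp add: product_action_def restrict_def)
  have T_meas: "?T g \<in> ?Q \<rightarrow>\<^sub>M ?Q" if g: "g \<in> carrier G" for g
  proof -
    note [measurable] = Ts_meas[OF g]
    have "(\<lambda>z n. Ts n g (z n)) \<in> ?Q \<rightarrow>\<^sub>M ?Q"
      by (rule measurable_PiM_single') (auto simp: space_PiM intro: measurable_space[OF Ts_meas[OF g]])
    then show ?thesis
      by (subst measurable_cong[OF T_eq])
  qed
  have "is_joining G UNIV Ms Ts J"
    unfolding is_joining_def
  proof (intro conjI ballI)
    show "prob_space J"
      unfolding J_def by (rule \<kappa>.prob_space_distr) measurable
    show "sets J = sets ?Q"
      by simp
    fix g assume g: "g \<in> carrier G"
    note [measurable] = T_meas[OF g] act_measurable[OF g]
    have act_P [measurable]: "(\<lambda>y n. \<phi> g (y n)) \<in> ?P \<rightarrow>\<^sub>M ?P"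
      by (rule measurable_PiM_single') (auto simp: space_PiM intro: measurable_space[OF act_measurable[OF g]])
    have "distr J J (?T g) = distr J ?Q (?T g)"
      by (rule distr_cong) simp_all
    also have "\<dots> = distr \<kappa> ?Q (\<lambda>y. ?T g (F y))"
      unfolding J_def by (subst distr_distr) (auto simp: comp_def)
    also have "\<dots> = distr \<kappa> ?Q (\<lambda>y. F (\<lambda>n. \<phi> g (y n)))"
    proof (rule distr_cong)
      fix y assume "y \<in> space \<kappa>"
      then have y: "y \<in> space ?P"
        by (simp add: \<kappa>_def)
      show "?T g (F y) = F (\<lambda>n. \<phi> g (y n))"
        using P_X[OF y] unfolding T_eq[OF measurable_space[OF F y]] by (simp add: F_def f_equiv[OF g])
    qed simp_all
    also have "\<dots> = distr (distr \<kappa> ?P (\<lambda>y n. \<phi> g (y n))) ?Q F"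
      by (subst distr_distr) (auto simp: comp_def)
    also have "\<dots> = J"
      unfolding \<kappa>_def K(4)[rule_format, OF g] by (simp add: J_def \<kappa>_def)
    finally show "distr J J (?T g) = J" .
  next
    fix n :: nat
    have "distr J (Ms n) (\<lambda>z. z n) = distr \<kappa> (Ms n) (\<lambda>y. f n (y n))"
      unfolding J_def by (subst distr_distr) (auto simp: comp_def F_def)
    also have "\<dots> = distr (distr \<kappa> B (\<lambda>y. y n)) (Ms n) (f n)"
      by (subst distr_distr) (auto simp: comp_def)
    finally show "distr J (Ms n) (\<lambda>z. z n) = Ms n"
      by (simp add: \<kappa>_coord f_distr)
  qed
  moreover have "\<forall>I Ms Ts L. I \<noteq> {} \<and> (\<forall>i\<in>I. (Ms i, Ts i) \<in> \<C>) \<and> is_joining G I Ms Ts L \<longrightarrow>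
        in_class G \<C> L (product_action I Ms Ts)"
    using \<C> unfolding characteristic_class_def by (elim conjE)
  ultimately have "in_class G \<C> J ?T"
    using MsC by simp
  then obtain R S where RC: "(R, S) \<in> \<C>" and isoR: "isomorphic_systems G J ?T R S"
    unfolding in_class_def by blast
  obtain h where h [measurable]: "h \<in> J \<rightarrow>\<^sub>M R" and h_bij: "bij_betw h (space J) (space R)"
      and hi: "inv_into (space J) h \<in> R \<rightarrow>\<^sub>M J" and h_distr: "distr J R h = R"
      and h_equiv: "\<forall>g\<in>carrier G. \<forall>z\<in>space J. h (?T g z) = S g (h z)"
    using isoR unfolding isomorphic_systems_def by blast
  define k where "k = inv_into (space J) h"
  have k [measurable]: "k \<in> R \<rightarrow>\<^sub>M ?Q"
    using hi by (simp add: k_def measurable_cong_sets[OF refl J_sets])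
  have k_h: "k (h z) = z" if "z \<in> space ?Q" for z
    using bij_betw_inv_into_left[OF h_bij] that by (simp add: k_def J_space)
  have h_k: "h (k z) = z" if "z \<in> space R" for z
    using bij_betw_inv_into_right[OF h_bij that] by (simp add: k_def)

  \<comment> \<open>Measurability, bijectivity and equivariance of \<open>f 0\<close> refer to
    \<open>B\<close> and to every point of \<open>X\<close>, not to null sets of \<open>N 0\<close>.
    Hence \<open>f 0\<close> transports \<open>M\<close> as well, even if \<open>M\<close> and
    \<open>N 0\<close> are mutually singular.\<close>
  define N0 where "N0 = distr M (Ms 0) (f 0)"
  have N0_sets [simp, measurable_cong]: "sets N0 = sets (Ms 0)" and N0_space: "space N0 = space (Ms 0)"
    by (simp_all add: N0_def)
  have f0 [measurable, simp]: "f 0 \<in> M \<rightarrow>\<^sub>M Ms 0" "f 0 \<in> B \<rightarrow>\<^sub>M N0" "f 0 \<in> M \<rightarrow>\<^sub>M N0"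
    using f[of 0] by (simp_all add: measurable_cong_sets[OF D(2) refl] measurable_cong_sets[OF refl N0_sets]
        measurable_cong_sets[OF D(2) N0_sets])
  have "mp_system G N0 (Ts 0)"
    unfolding mp_system_def
  proof (intro conjI ballI)
    \<comment> \<open>Both properties see only the measurable space and the action, which are those
      of \<open>Ms 0\<close>.\<close>
    show "standard_borel N0" "group_action G (space N0) (Ts 0)"
      using sys[of 0] by (simp_all add: mp_system_def standard_borel_def N0_space)
    show "prob_space N0"
      unfolding N0_def by (rule M.prob_space_distr[OF f0(1)])
    fix g assume g: "g \<in> carrier G"
    note [measurable] = Ts_meas[OF g] D(5)[OF g]
    show "Ts 0 g \<in> N0 \<rightarrow>\<^sub>M N0"
      by measurable
    have "distr N0 N0 (Ts 0 g) = distr N0 (Ms 0) (Ts 0 g)"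
      by (rule distr_cong) simp_all
    also have "\<dots> = distr M (Ms 0) (\<lambda>x. Ts 0 g (f 0 x))"
      unfolding N0_def by (subst distr_distr) (auto simp: comp_def)
    also have "\<dots> = distr M (Ms 0) (\<lambda>x. f 0 (\<phi> g x))"
      using f_equiv[OF g] by (intro distr_cong) (simp_all add: D(3))
    also have "\<dots> = distr (distr M M (\<phi> g)) (Ms 0) (f 0)"
      by (subst distr_distr) (auto simp: comp_def)
    finally show "distr N0 N0 (Ts 0 g) = N0"
      by (simp add: D(4)[OF g] N0_def)
  qed

  \<comment> \<open>Undo \<open>h\<close>, decode each coordinate into \<open>X\<close>, take the
    limit and encode it by \<open>f 0\<close>. The default value in \<open>lim_in\<close> makes this
    a total measurable map.\<close>
  define \<pi> where "\<pi> z = f 0 (lim_in X (Fi (k z)))" for z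
  have lim_P [measurable]: "(\<lambda>y. lim_in X y) \<in> ?P \<rightarrow>\<^sub>M B"
    by (rule measurable_lim_in[OF compact coord])
  have "is_factor G N0 (Ts 0) R S"
    unfolding is_factor_def
  proof (rule bexI[of _ \<pi>], rule conjI)
    show "\<pi> \<in> R \<rightarrow>\<^sub>M N0"
      unfolding \<pi>_def by measurable
    have Cauchy_P [measurable]: "Measurable.pred ?P Cauchy"
      using measurable_Cauchy_compact[OF compact coord] by simp
    have "AE y in \<kappa>. Cauchy y"
    proof -
      have "AE p in K. Cauchy (snd p)"
        using conv by eventually_elim (rule LIMSEQ_imp_Cauchy)
      then show ?thesis
        unfolding \<kappa>_def by (subst AE_distr_iff) (auto intro: predE)
    qed
    \<comment> \<open>The almost sure Cauchy property is carried along the successive image measures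
      \<kappa>, \<open>J\<close> and \<open>R\<close>.\<close>
    then have "AE y in \<kappa>. Cauchy (Fi (F y))"
      using AE_space by eventually_elim (simp add: Fi_F \<kappa>_def)
    then have "AE z in J. Cauchy (Fi z)"
      unfolding J_def by (subst AE_distr_iff) (auto intro!: predE)
    then have "AE z in J. Cauchy (Fi (k (h z)))"
      using AE_space by eventually_elim (simp add: k_h J_space)
    then have "AE z in distr J R h. Cauchy (Fi (k z))"
      by (subst AE_distr_iff) (auto intro!: predE)
    then have "AE z in R. Cauchy (Fi (k z))"
      by (simp only: h_distr)
    \<comment> \<open>One null set serves all group elements: wherever the decoded sequence is
      Cauchy, equivariance of the limit is just continuity of \<open>\<phi> g\<close>.\<close>
    then show "AE z in R. \<forall>g\<in>carrier G. \<pi> (S g z) = Ts 0 g (\<pi> z)"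
      using AE_space
    proof eventually_elim
      case (elim z)
      define w where "w = k z"
      have w: "w \<in> space ?Q"
        unfolding w_def by (rule measurable_space[OF k elim(2)])
      define y where "y = Fi w"
      have y: "y \<in> space ?P"
        unfolding y_def by (rule measurable_space[OF Fi w])
      have "Cauchy y"
        using elim(1) by (simp add: y_def w_def)
      from lim_in_tendsto[OF compact P_X[OF y] this] have lim: "y \<longlonglongrightarrow> lim_in X y" "lim_in X y \<in> X"
        by simp_all
      show ?case
      proof
        fix g assume g: "g \<in> carrier G"
        have "S g z = h (?T g w)"
          using h_equiv g w by (simp add: J_space w_def h_k[OF elim(2)])
        then have "k (S g z) = ?T g w"
          using measurable_space[OF T_meas[OF g] w] by (simp add: k_h)
        moreover have "Fi (?T g w) = (\<lambda>n. \<phi> g (y n))"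
        proof
          fix n
          have wn: "w n \<in> space (Ms n)"
            by (rule Q_coord[OF w])
          have "fi n (Ts n g (w n)) = fi n (Ts n g (f n (y n)))"
            by (simp add: y_def Fi_def f_fi[OF wn])
          also have "\<dots> = \<phi> g (y n)"
            using P_X[OF y, of n] by (simp add: f_equiv[OF g, symmetric] fi_f act_X[OF g])
          finally show "Fi (?T g w) n = \<phi> g (y n)"
            by (simp add: T_eq[OF w] Fi_def)
        qed
        moreover have "(\<lambda>n. \<phi> g (y n)) \<longlonglongrightarrow> \<phi> g (lim_in X y)"
          by (rule continuous_on_tendsto_compose[OF homeomorphism_cont1[OF homeo[OF g]] lim])
            (simp add: P_X[OF y])
        ultimately have "\<pi> (S g z) = f 0 (\<phi> g (lim_in X y))"
          by (simp add: \<pi>_def lim_in_eq)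
        then show "\<pi> (S g z) = Ts 0 g (\<pi> z)"
          unfolding f_equiv[OF g lim(2)] by (simp add: \<pi>_def y_def w_def)
      qed
    qed
    \<comment> \<open>The image measure is traced back to \<open>K\<close>, where the limit of the
      second coordinates is almost surely the first coordinate, whose law is
      \<open>M\<close>.\<close>
    have "distr R N0 \<pi> = distr (distr J R h) N0 \<pi>"
      by (simp only: h_distr)
    also have "\<dots> = distr J N0 (\<lambda>z. \<pi> (h z))"
      unfolding \<pi>_def by (subst distr_distr) (auto simp: comp_def)
    also have "\<dots> = distr J N0 (\<lambda>z. f 0 (lim_in X (Fi z)))"
      by (rule distr_cong) (simp_all add: \<pi>_def k_h J_space)
    also have "\<dots> = distr \<kappa> N0 (\<lambda>y. f 0 (lim_in X (Fi (F y))))"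
      unfolding J_def by (subst distr_distr) (auto simp: comp_def)
    also have "\<dots> = distr \<kappa> N0 (\<lambda>y. f 0 (lim_in X y))"
      by (rule distr_cong) (simp_all add: Fi_F \<kappa>_def)
    also have "\<dots> = distr K N0 (\<lambda>p. f 0 (lim_in X (snd p)))"
      unfolding \<kappa>_def by (subst distr_distr) (auto simp: comp_def)
    also have "\<dots> = distr K N0 (\<lambda>p. f 0 (fst p))"
    proof (rule distr_cong_AE)
      show "AE p in K. f 0 (lim_in X (snd p)) = f 0 (fst p)"
        using conv by eventually_elim (simp add: lim_in_eq)
    qed simp_all
    also have "\<dots> = distr (distr K B fst) N0 (f 0)"
      by (subst distr_distr) (auto simp: comp_def)
    also have "\<dots> = distr M (Ms 0) (f 0)"
      unfolding K_fst by (rule distr_cong) simp_all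
    finally show "distr R N0 \<pi> = N0"
      by (simp add: N0_def)
  qed
  moreover have "\<forall>(M, T)\<in>\<C>. \<forall>N S. mp_system G N S \<and> is_factor G N S M T \<longrightarrow> (N, S) \<in> \<C>"
    using \<C> unfolding characteristic_class_def by (elim conjE)
  ultimately have N0C: "(N0, Ts 0) \<in> \<C>"
    using RC \<open>mp_system G N0 (Ts 0)\<close> by blast
  have "isomorphic_systems G M \<phi> N0 (Ts 0)"
    unfolding isomorphic_systems_def
  proof (rule bexI[of _ "f 0"], intro conjI ballI)
    show "bij_betw (f 0) (space M) (space N0)"
      using f_bij[of 0] by (simp add: D(3) DN(3) N0_space)
    show "inv_into (space M) (f 0) \<in> N0 \<rightarrow>\<^sub>M M"
      using fi[of 0] by (simp add: D(3) fi_def measurable_cong_sets[OF N0_sets D(2)])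
    show "distr M N0 (f 0) = N0"
      unfolding N0_def by (rule distr_cong) simp_all
    show "f 0 (\<phi> g x) = Ts 0 g (f 0 x)" if "g \<in> carrier G" "x \<in> space M" for g x
      using f_equiv that by (simp add: D(3))
    show "f 0 \<in> M \<rightarrow>\<^sub>M N0"
      by simp
  qed
  with N0C show ?thesis
    unfolding in_class_def by blast
qed

text \<open>If every ball around \<open>M\<close> meets the set, the radii
  \<open>(1 / 2) ^ n\<close> supply approximating measures whose joinings with \<open>M\<close> have
  summable cost, as \<open>in_class_limit\<close> requires.\<close>

lemma closedin_ergodic_class_measures:
  assumes \<C>: "characteristic_class G \<C>"
  shows "closedin (Metric_space.mtopology \<M> (rho_bar G X \<phi>)) (ergodic_class_measures G X \<phi> \<C>)"
proof -
  interpret R: Metric_space \<M> "rho_bar G X \<phi>" by (rule Metric_space_rho_bar)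
  let ?E = "ergodic_class_measures G X \<phi> \<C>"
  show ?thesis
    unfolding R.closedin_metric
  proof (intro conjI allI impI)
    show "?E \<subseteq> \<M>"
      by (auto simp: ergodic_class_measures_def)
    fix M assume M: "M \<in> \<M> - ?E"
    show "\<exists>r>0. disjnt ?E (R.mball M r)"
    proof (rule ccontr)
      assume no: "\<not> (\<exists>r>0. disjnt ?E (R.mball M r))"
      have near: "\<exists>N. N \<in> \<M> \<and> ergodic G \<phi> N \<and> in_class G \<C> N \<phi> \<and> rho_bar G X \<phi> M N < r" if "0 < r" for r
        using no that by (auto simp: disjnt_iff ergodic_class_measures_def)
      have "ergodic G \<phi> M"
        using near M by (intro ergodic_closed) blast+
      moreover have "in_class G \<C> M \<phi>"
      proof -
        have "\<exists>N L. N \<in> \<M> \<and> in_class G \<C> N \<phi> \<and> L \<in> joinings G \<phi> M N \<and> cost L \<le> (1 / 2) ^ n" for n :: nat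
        proof -
          obtain N where N: "N \<in> \<M>" "in_class G \<C> N \<phi>" "rho_bar G X \<phi> M N < (1 / 2) ^ n"
            using near[of "(1 / 2) ^ n"] by auto
          obtain L where "L \<in> joinings G \<phi> M N" "cost L < (1 / 2) ^ n"
            by (rule rho_bar_less[OF _ N(1,3)]) (use M in auto)
          with N show ?thesis
            by (meson less_imp_le)
        qed
        then obtain N L where N: "\<And>n. N n \<in> \<M>" "\<And>n. in_class G \<C> (N n) \<phi>"
            and L: "\<And>n. L n \<in> joinings G \<phi> M (N n)" "\<And>n. cost (L n) \<le> (1 / 2) ^ n"
          by metis
        show ?thesis
          by (rule in_class_limit[where N=N and L=L, OF \<C> _ N L]) (use M in simp)
      qed
      ultimately show False
        using M by (simp add: ergodic_class_measures_def)
    qed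
  qed
qed

end

theorem corollary4p4:
  fixes G :: "('g, 'b) monoid_scheme"
    and X :: "'x::metric_space set"
    and \<phi> :: "'g \<Rightarrow> 'x \<Rightarrow> 'x"
    and \<C> :: "'g system_class"
  assumes "group G" and "countable (carrier G)" and "amenable G"
    and "compact X"
    and "group_action G X \<phi>"
    and "\<And>g. g \<in> carrier G \<Longrightarrow> homeomorphism X X (\<phi> g) (\<phi> (inv\<^bsub>G\<^esub> g))"
    and "characteristic_class G \<C>"
  shows "closedin (Metric_space.mtopology (invariant_measures G X \<phi>) (rho_bar G X \<phi>))
           (ergodic_class_measures G X \<phi> \<C>)"
proof -
  interpret compact_action G X \<phi>
    by (rule compact_action.intro) fact+
  show ?thesis
    by (rule closedin_ergodic_class_measures) fact
qed

end
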